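(* Let $H_1$, $H_2$ and $K$ be Hilbert spaces and $\mathcal A\subseteq\mathcal B(H_1)$ and $\mathcal B\subseteq\mathcal B(H_2)$ be weak* closed unital algebras. Suppose that $\mathcal A$ is spatially embedded in $\mathcal B$ and let $\mathcal U\subseteq\mathcal B(K)$ be a weak* closed subspace such that $\mathcal F(\mathcal B,\mathcal U)=\mathcal B\bar\otimes\mathcal U$. Then $\mathcal F(\mathcal A,\mathcal U)=\mathcal A\bar\otimes\mathcal U$.
   Context: For subspaces $\mathcal X,\mathcal Y$ of operators, $[\mathcal X\mathcal Y]$ denotes the weak* closure of the set of finite sums $\sum_{i=1}^kX_iY_i$, $X_i\in\mathcal X$, $Y_i\in\mathcal Y$. $\mathcal A$ is spatially embedded in $\mathcal B$ if there exist a $\mathcal B,\mathcal A$-bimodule $\mathcal X\subseteq\mathcal B(H_1,H_2)$ and an $\mathcal A,\mathcal B$-bimodule $\mathcal Y\subseteq\mathcal B(H_2,H_1)$ such that $[\mathcal X\mathcal Y]\subseteq\mathcal B$ and $[\mathcal Y\mathcal X]=\mathcal A$ (a $\mathcal B,\mathcal A$-bimodule is a linear subspace $\mathcal X$ with $BXA\in\mathcal X$ for $B\in\mathcal B$, $X\in\mathcal X$, $A\in\mathcal A$). For weak* closed subspaces $\mathcal V\subseteq\mathcal B(H)$, $\mathcal U\subseteq\mathcal B(K)$, $\mathcal V\bar\otimes\mathcal U$ is the weak* closed linear span of $\{S\otimes T:S\in\mathcal V,T\in\mathcal U\}$ in $\mathcal B(H\otimes K)$. For a weak* continuous functional $\omega\in\mathcal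 V_*$, $R_\omega:\mathcal V\bar\otimes\mathcal B(K)\to\mathcal B(K)$ is the weak* continuous linear map with $R_\omega(A\otimes B)=\omega(A)B$; the Fubini product is $\mathcal F(\mathcal V,\mathcal U)=\{T\in\mathcal V\bar\otimes\mathcal B(K):R_\omega(T)\in\mathcal U\text{ for all }\omega\in\mathcal V_*\}$. *)

theory Defs
  imports "HOL-Analysis.Analysis"
begin

section \<open>Complex Hilbert spaces\<close>

class complex_vector = ab_group_add +
  fixes scaleC :: "complex \<Rightarrow> 'a \<Rightarrow> 'a" (infixr \<open>*\<^sub>C\<close> 75)
  assumes scaleC_add_right: "c *\<^sub>C (x + y) = c *\<^sub>C x + c *\<^sub>C y"
    and scaleC_add_left: "(c + d) *\<^sub>C x = c *\<^sub>C x + d *\<^sub>C x"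
    and scaleC_scaleC: "c *\<^sub>C (d *\<^sub>C x) = (c * d) *\<^sub>C x"
    and scaleC_one: "1 *\<^sub>C x = x"

global_interpretation complex_vector: vector_space "scaleC :: complex \<Rightarrow> 'a \<Rightarrow> 'a::complex_vector"
  defines csubspace = complex_vector.subspace
    and cspan = complex_vector.span
  by standard (simp_all add: scaleC_add_right scaleC_add_left scaleC_scaleC scaleC_one)

text \<open>
  The inner product \<open>cinner\<close> is linear in its first argument. The underlying real Hilbert space
  structure has inner product \<open>Re (cinner x y)\<close>; it supplies positive definiteness and, through
  class \<open>real_inner\<close>, the norm \<open>sqrt (Re (cinner x x))\<close>, which is required to be complete.
\<close>

class complex_hilbert = complex_vector + real_inner + complete_space +
  fixes cinner :: "'a \<Rightarrow> 'a \<Rightarrow> complex"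
  assumes scaleR_scaleC: "r *\<^sub>R x = complex_of_real r *\<^sub>C x"
    and cinner_add_left: "cinner (x + y) z = cinner x z + cinner y z"
    and cinner_scaleC_left: "cinner (c *\<^sub>C x) y = c * cinner x y"
    and cinner_commute: "cinner x y = cnj (cinner y x)"
    and inner_eq_Re_cinner: "inner x y = Re (cinner x y)"

instantiation complex :: complex_hilbert
begin
definition "c *\<^sub>C (x::complex) = c * x"
definition "cinner (x::complex) y = x * cnj y"
instance
  by standard
    (simp_all add: scaleC_complex_def cinner_complex_def algebra_simps scaleR_conv_of_real
      inner_complex_def)
end

definition clinear_on :: "'a::complex_vector set \<Rightarrow> ('a \<Rightarrow> 'b::complex_vector) \<Rightarrow> bool" where
  "clinear_on V f \<longleftrightarrow>
     (\<forall>x\<in>V. \<forall>y\<in>V. f (x + y) = f x + f y) \<and> (\<forall>c. \<forall>x\<in>V. f (c *\<^sub>C x) = c *\<^sub>C f x)"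


section \<open>Bounded operators and the weak* topology\<close>

lemma bounded_linear_scaleC:
  "bounded_linear (\<lambda>x::'a::complex_hilbert. c *\<^sub>C x)"
proof (rule bounded_linear_intro[where K = "cmod c"])
  fix x y :: 'a and r :: real
  show "c *\<^sub>C (x + y) = c *\<^sub>C x + c *\<^sub>C y" by (rule scaleC_add_right)
  show "c *\<^sub>C (r *\<^sub>R x) = r *\<^sub>R (c *\<^sub>C x)"
    by (simp add: scaleR_scaleC scaleC_scaleC mult.commute)
  have right: "cinner u (c *\<^sub>C v) = cnj c * cinner u v" for u v :: 'a
    by (metis cinner_commute cinner_scaleC_left complex_cnj_mult)
  have "cinner (c *\<^sub>C x) (c *\<^sub>C x) = complex_of_real ((cmod c)\<^sup>2) * cinner x x"
    by (simp only: cinner_scaleC_left right complex_norm_square) (simp add: mult_ac)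
  then have "inner (c *\<^sub>C x) (c *\<^sub>C x) = (cmod c)\<^sup>2 * inner x x"
    by (simp only: inner_eq_Re_cinner) simp
  then show "norm (c *\<^sub>C x) \<le> norm x * cmod c"
    by (simp add: norm_eq_sqrt_inner real_sqrt_mult)
qed

typedef (overloaded) ('a::complex_hilbert, 'b::complex_hilbert) bop =
  "{f :: 'a \<Rightarrow> 'b. bounded_linear f \<and> (\<forall>c x. f (c *\<^sub>C x) = c *\<^sub>C f x)}"
  morphisms bop_apply Bop
  by (rule exI[where x = "\<lambda>_. 0"]) (simp add: complex_vector.scale_zero_right)

setup_lifting type_definition_bop

instantiation bop :: (complex_hilbert, complex_hilbert) complex_vector
begin
lift_definition zero_bop :: "('a, 'b) bop" is "\<lambda>_. 0"
  by (simp add: complex_vector.scale_zero_right)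
lift_definition plus_bop :: "('a, 'b) bop \<Rightarrow> ('a, 'b) bop \<Rightarrow> ('a, 'b) bop"
  is "\<lambda>S T x. S x + T x"
  by (simp add: bounded_linear_add scaleC_add_right)
lift_definition uminus_bop :: "('a, 'b) bop \<Rightarrow> ('a, 'b) bop" is "\<lambda>T x. - T x"
  by (simp add: bounded_linear_minus complex_vector.scale_minus_right)
lift_definition minus_bop :: "('a, 'b) bop \<Rightarrow> ('a, 'b) bop \<Rightarrow> ('a, 'b) bop"
  is "\<lambda>S T x. S x - T x"
  by (simp add: bounded_linear_sub complex_vector.scale_right_diff_distrib)
lift_definition scaleC_bop :: "complex \<Rightarrow> ('a, 'b) bop \<Rightarrow> ('a, 'b) bop" is "\<lambda>c T x. c *\<^sub>C T x"
  by (simp add: bounded_linear_compose[OF bounded_linear_scaleC] scaleC_scaleC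
      mult.commute)
instance
  by standard
    (transfer; simp add: fun_eq_iff scaleC_add_right scaleC_add_left scaleC_scaleC scaleC_one
      add.assoc add.commute)+
end

lift_definition bop_id :: "('a::complex_hilbert, 'a) bop" is "\<lambda>x. x"
  by simp

lift_definition bop_comp ::
  "('b::complex_hilbert, 'c::complex_hilbert) bop \<Rightarrow> ('a::complex_hilbert, 'b) bop \<Rightarrow> ('a, 'c) bop"
  (infixl \<open>\<cdot>\<close> 70) is "\<lambda>S T x. S (T x)"
  by (simp add: bounded_linear_compose)

text \<open>
  The weak* topology of \<open>B(H,K)\<close> is induced by its predual, the trace class operators. Every trace
  class operator is a sum of rank one operators built from two square summable sequences, and pairing
  with it is one of the following functionals (also for nonseparable spaces).
\<close>

definition square_summable :: "(nat \<Rightarrow> 'a::complex_hilbert) \<Rightarrow> bool" where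
  "square_summable x \<longleftrightarrow> summable (\<lambda>n. (norm (x n))\<^sup>2)"

definition normal_functionals :: "(('a::complex_hilbert, 'b::complex_hilbert) bop \<Rightarrow> complex) set"
  where "normal_functionals =
    {(\<lambda>T. \<Sum>n. cinner (bop_apply T (x n)) (y n)) | x y. square_summable x \<and> square_summable y}"

definition weak_star :: "('a::complex_hilbert, 'b::complex_hilbert) bop topology" where
  "weak_star = topology_generated_by {\<phi> -` G | \<phi> G. \<phi> \<in> normal_functionals \<and> open G}"

definition weak_star_closed_subspace :: "('a::complex_hilbert, 'b::complex_hilbert) bop set \<Rightarrow> bool"
  where "weak_star_closed_subspace V \<longleftrightarrow> csubspace V \<and> closedin weak_star V"

text \<open>The algebra is unital in the sense that it contains the identity operator.\<close>

definition weak_star_closed_unital_algebra :: "('a::complex_hilbert, 'a) bop set \<Rightarrow> bool" where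
  "weak_star_closed_unital_algebra A \<longleftrightarrow>
     weak_star_closed_subspace A \<and> (\<forall>S\<in>A. \<forall>T\<in>A. S \<cdot> T \<in> A) \<and> bop_id \<in> A"


section \<open>Spatial embedding\<close>

definition bimodule :: "('b::complex_hilbert, 'b) bop set \<Rightarrow> ('a::complex_hilbert, 'a) bop set \<Rightarrow>
    ('a, 'b) bop set \<Rightarrow> bool" where
  "bimodule B A X \<longleftrightarrow> csubspace X \<and> (\<forall>b\<in>B. \<forall>x\<in>X. \<forall>a\<in>A. b \<cdot> x \<cdot> a \<in> X)"

definition closed_product :: "('b::complex_hilbert, 'c::complex_hilbert) bop set \<Rightarrow>
    ('a::complex_hilbert, 'b) bop set \<Rightarrow> ('a, 'c) bop set" where
  "closed_product X Y = weak_star closure_of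
     {(\<Sum>i<k. x i \<cdot> y i) | (k::nat) x y. (\<forall>i<k. x i \<in> X) \<and> (\<forall>i<k. y i \<in> Y)}"

definition spatially_embedded ::
  "('a::complex_hilbert, 'a) bop set \<Rightarrow> ('b::complex_hilbert, 'b) bop set \<Rightarrow> bool" where
  "spatially_embedded A B \<longleftrightarrow>
     (\<exists>(X :: ('a, 'b) bop set) (Y :: ('b, 'a) bop set).
        bimodule B A X \<and> bimodule A B Y \<and> closed_product X Y \<subseteq> B \<and> closed_product Y X = A)"


section \<open>Tensor products and Fubini products\<close>

text \<open>
  \<open>hilbert_tensor t\<close> says that the Hilbert space \<open>'p\<close>, with elementary tensors \<open>t h k\<close>, is the
  Hilbert space tensor product of \<open>'h\<close> and \<open>'k\<close>. This determines \<open>'p\<close> and \<open>t\<close> up to a unique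
  unitary.
\<close>

definition hilbert_tensor ::
  "('h::complex_hilbert \<Rightarrow> 'k::complex_hilbert \<Rightarrow> 'p::complex_hilbert) \<Rightarrow> bool" where
  "hilbert_tensor t \<longleftrightarrow>
     (\<forall>k. clinear_on UNIV (\<lambda>h. t h k)) \<and> (\<forall>h. clinear_on UNIV (t h)) \<and>
     (\<forall>h k h' k'. cinner (t h k) (t h' k') = cinner h h' * cinner k k') \<and>
     closure (cspan {t h k | h k. True}) = UNIV"

text \<open>The unique bounded operator sending \<open>h \<otimes> k\<close> to \<open>S h \<otimes> T k\<close>.\<close>

definition tensor_op :: "('h::complex_hilbert \<Rightarrow> 'k::complex_hilbert \<Rightarrow> 'p::complex_hilbert) \<Rightarrow>
    ('h, 'h) bop \<Rightarrow> ('k, 'k) bop \<Rightarrow> ('p, 'p) bop" where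
  "tensor_op t S T =
     (THE W. \<forall>h k. bop_apply W (t h k) = t (bop_apply S h) (bop_apply T k))"

definition weak_star_tensor :: "('h::complex_hilbert \<Rightarrow> 'k::complex_hilbert \<Rightarrow> 'p::complex_hilbert) \<Rightarrow>
    ('h, 'h) bop set \<Rightarrow> ('k, 'k) bop set \<Rightarrow> ('p, 'p) bop set" where
  "weak_star_tensor t V U = weak_star closure_of cspan {tensor_op t S T | S T. S \<in> V \<and> T \<in> U}"

definition predual :: "('h::complex_hilbert, 'h) bop set \<Rightarrow> (('h, 'h) bop \<Rightarrow> complex) set" where
  "predual V = {\<omega>. clinear_on V \<omega> \<and> continuous_map (subtopology weak_star V) euclidean \<omega>}"

text \<open>
  Elements of \<open>predual V\<close> and slice maps are total functions of which only the values on \<open>V\<close>,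
  respectively on the weak* closed tensor product of \<open>V\<close> with \<open>B(K)\<close>, are meaningful. On the latter
  space the slice map exists and is unique by weak* density of the span of elementary tensors, so
  the choice made in \<open>right_slice\<close> is immaterial.
\<close>

definition is_right_slice :: "('h::complex_hilbert \<Rightarrow> 'k::complex_hilbert \<Rightarrow> 'p::complex_hilbert) \<Rightarrow>
    ('h, 'h) bop set \<Rightarrow> (('h, 'h) bop \<Rightarrow> complex) \<Rightarrow> (('p, 'p) bop \<Rightarrow> ('k, 'k) bop) \<Rightarrow> bool" where
  "is_right_slice t V \<omega> R \<longleftrightarrow>
     clinear_on (weak_star_tensor t V UNIV) R \<and>
     continuous_map (subtopology weak_star (weak_star_tensor t V UNIV)) weak_star R \<and>
     (\<forall>A\<in>V. \<forall>B. R (tensor_op t A B) = \<omega> A *\<^sub>C B)"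

definition right_slice :: "('h::complex_hilbert \<Rightarrow> 'k::complex_hilbert \<Rightarrow> 'p::complex_hilbert) \<Rightarrow>
    ('h, 'h) bop set \<Rightarrow> (('h, 'h) bop \<Rightarrow> complex) \<Rightarrow> ('p, 'p) bop \<Rightarrow> ('k, 'k) bop" where
  "right_slice t V \<omega> = (SOME R. is_right_slice t V \<omega> R)"

definition fubini :: "('h::complex_hilbert \<Rightarrow> 'k::complex_hilbert \<Rightarrow> 'p::complex_hilbert) \<Rightarrow>
    ('h, 'h) bop set \<Rightarrow> ('k, 'k) bop set \<Rightarrow> ('p, 'p) bop set" where
  "fubini t V U = {T \<in> weak_star_tensor t V UNIV. \<forall>\<omega> \<in> predual V. right_slice t V \<omega> T \<in> U}"

end

theory Submission
  imports Defs
begin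

text \<open>
  Let \<open>X\<close> and \<open>Y\<close> be the bimodules of the spatial embedding. For \<open>x \<in> X\<close> and \<open>y \<in> Y\<close> the map
  \<open>S \<mapsto> x S y\<close> sends \<open>A\<close> into \<open>B\<close>, because \<open>X A \<subseteq> X\<close> and \<open>X Y \<subseteq> B\<close>. Its ampliation
  \<open>T \<mapsto> (x \<otimes> 1) T (y \<otimes> 1)\<close> sends the Fubini product of \<open>A\<close> and \<open>U\<close> into that of \<open>B\<close> and \<open>U\<close>: a slice
  of the image by \<open>\<phi>\<close> is a slice of \<open>T\<close> by \<open>S \<mapsto> \<phi> (x S y)\<close> (\<open>fubini_compress\<close>). By hypothesis the
  image lies in the weak* closed tensor product of \<open>B\<close> and \<open>U\<close>, and compressing it again by \<open>y' \<in> Y\<close>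
  and \<open>x' \<in> X\<close> leads to the tensor product of \<open>A\<close> and \<open>U\<close> (\<open>weak_star_tensor_compress\<close>). So
  \<open>(c \<otimes> 1) T (d \<otimes> 1)\<close> is in that tensor product whenever \<open>c\<close> and \<open>d\<close> are products from \<open>Y X\<close>. Since
  \<open>A\<close> is unital, the identity is a weak* limit of sums of such products, and since multiplication by a
  fixed operator and \<open>c \<mapsto> c \<otimes> 1\<close> are weak* continuous (\<open>normal_compose\<close>, \<open>normal_ampliation\<close>), both
  \<open>c\<close> and \<open>d\<close> can be replaced by the identity, one after the other.

  All weak* arguments are carried out with normal functionals instead of nets. An operator is in the
  weak* closure of a span if and only if every normal functional that vanishes on the generators
  vanishes on it (\<open>weak_star_closure_cspan_iff\<close>), and the predual of a subspace consists of restrictions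
  of normal functionals (\<open>predual_eq_normal\<close>). A linear map then respects weak* closed spans as soon as
  composition with it preserves normality. For ampliations and slice maps this amounts to rewriting a
  series of normal functionals as a single one, for which \<open>nuclear_bound_suminf\<close> is the tool.
\<close>

section \<open>Complex inner products and the Riesz representation\<close>

instance complex_hilbert \<subseteq> banach ..

lemma cinner_add_right: "cinner x (y + z) = cinner x y + cinner x z"
  by (metis cinner_add_left cinner_commute complex_cnj_add)

lemma cinner_scaleC_right: "cinner x (c *\<^sub>C y) = cnj c * cinner x y"
  by (metis cinner_scaleC_left cinner_commute complex_cnj_mult)

lemma cinner_self: "cinner x x = complex_of_real ((norm x)\<^sup>2)"
proof (rule complex_eqI)
  show "Re (cinner x x) = Re (complex_of_real ((norm x)\<^sup>2))"
    by (simp add: inner_eq_Re_cinner[symmetric] dot_square_norm)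
  have "cinner x x = cnj (cinner x x)" by (rule cinner_commute)
  then have "Im (cinner x x) = - Im (cinner x x)" by (metis cnj.simps(2))
  then show "Im (cinner x x) = Im (complex_of_real ((norm x)\<^sup>2))" by simp
qed

lemma norm_scaleC: "norm (c *\<^sub>C (x::'a::complex_hilbert)) = cmod c * norm x"
proof -
  have "complex_of_real ((norm (c *\<^sub>C x))\<^sup>2) = complex_of_real ((cmod c * norm x)\<^sup>2)"
    unfolding cinner_self[symmetric] cinner_scaleC_left cinner_scaleC_right
    by (simp add: cinner_self complex_norm_square power_mult_distrib mult_ac del: of_real_power)
  then have "(norm (c *\<^sub>C x))\<^sup>2 = (cmod c * norm x)\<^sup>2" using of_real_eq_iff by blast
  then show ?thesis by simp
qed

lemma norm_cinner_le: "cmod (cinner x y) \<le> norm x * norm y"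
proof (cases "cinner x y = 0")
  case False
  define c where "c = cnj (cinner x y) / cmod (cinner x y)"
  have c: "cmod c = 1" using False by (simp add: c_def norm_divide)
  have "c * cinner x y = complex_of_real (cmod (cinner x y))"
    using False by (simp add: c_def mult.commute complex_norm_square[symmetric] power2_eq_square)
  then have "cmod (cinner x y) = Re (cinner (c *\<^sub>C x) y)" by (simp add: cinner_scaleC_left)
  also have "\<dots> \<le> norm (c *\<^sub>C x) * norm y"
    unfolding inner_eq_Re_cinner[symmetric] by (rule norm_cauchy_schwarz)
  finally show ?thesis by (simp add: norm_scaleC c)
qed simp

interpretation cinner: bounded_bilinear "cinner :: 'a::complex_hilbert \<Rightarrow> 'a \<Rightarrow> complex"
proof
  fix a a' b b' :: 'a and r :: real
  show "cinner (a + a') b = cinner a b + cinner a' b" by (rule cinner_add_left)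
  show "cinner a (b + b') = cinner a b + cinner a b'" by (rule cinner_add_right)
  show "cinner (r *\<^sub>R a) b = r *\<^sub>R cinner a b"
    unfolding scaleR_scaleC[of r a] by (simp add: cinner_scaleC_left scaleR_conv_of_real)
  show "cinner a (r *\<^sub>R b) = r *\<^sub>R cinner a b"
    unfolding scaleR_scaleC[of r b] by (simp add: cinner_scaleC_right scaleR_conv_of_real)
  show "\<exists>K. \<forall>a b::'a. norm (cinner a b) \<le> norm a * norm b * K"
    by (rule exI[of _ 1]) (simp add: norm_cinner_le)
qed

lemma cinner_eqI: "x = y" if "\<And>z. cinner x z = cinner y z"
proof -
  have "cinner (x - y) (x - y) = 0" using that by (simp add: cinner.diff_left)
  then show ?thesis by (simp add: cinner_self)
qed

lemma bounded_linear_bop: "bounded_linear (bop_apply T)"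
  using bop_apply[of T] by simp

lemma bop_add: "bop_apply T (x + y) = bop_apply T x + bop_apply T y"
  by (simp add: bounded_linear_bop linear_simps)

lemma bop_zero: "bop_apply T 0 = 0"
  by (simp add: bounded_linear_bop linear_simps)

lemma bop_scaleC: "bop_apply T (c *\<^sub>C x) = c *\<^sub>C bop_apply T x"
  using bop_apply[of T] by simp

lemma bop_sum: "bop_apply T (sum f I) = (\<Sum>i\<in>I. bop_apply T (f i))"
  using linear_sum[OF bounded_linear.linear[OF bounded_linear_bop]] by blast

lemma bop_norm_bound: obtains K where "K > 0" "\<And>x. norm (bop_apply T x) \<le> K * norm x"
  using bounded_linear.pos_bounded[OF bounded_linear_bop[of T]] by (metis mult.commute)

lemma bop_eqI: "S = T" if "\<And>x. bop_apply S x = bop_apply T x"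
  using that by (metis bop_apply_inject ext)

lemma bop_apply_Bop:
  assumes "\<And>x y. f (x + y) = f x + f y" "\<And>c x. f (c *\<^sub>C x) = c *\<^sub>C f x"
    and "\<And>x. norm (f x) \<le> norm x * K"
  shows "bop_apply (Bop f) = f"
proof -
  have "bounded_linear f"
    using assms by (intro bounded_linear_intro[where K = K]) (auto simp: scaleR_scaleC)
  then show ?thesis using assms(2) by (simp add: Bop_inverse)
qed

text \<open>The representing vector minimises \<open>|x|\<^sup>2 - 2 f x\<close>: the parallelogram law makes minimising sequences Cauchy, and the
  first variation at the minimum says that it represents \<open>f\<close>.\<close>

lemma riesz_real:
  fixes f :: "'a::{real_inner,complete_space} \<Rightarrow> real"
  assumes f: "bounded_linear f"
  obtains z where "\<And>x. f x = inner z x"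
proof -
  interpret f: bounded_linear f by (rule f)
  define J where "J x = (norm x)\<^sup>2 - 2 * f x" for x
  obtain K where K: "\<And>x. norm (f x) \<le> norm x * K" using f.bounded by blast
  have lower: "J x \<ge> - K\<^sup>2" for x
  proof -
    have "f x \<le> norm x * K" using K[of x] by simp
    moreover have "(norm x - K)\<^sup>2 \<ge> 0" by simp
    ultimately show ?thesis by (simp add: J_def power2_diff algebra_simps)
  qed
  then have bdd: "bdd_below (range J)" by (intro bdd_belowI2)
  define d where "d = Inf (range J)"
  have d: "d \<le> J x" for x unfolding d_def by (intro cInf_lower bdd) simp
  have "\<exists>x. J x < d + 1 / real (Suc n)" for n
    using cInf_lessD[of "range J" "d + 1 / real (Suc n)"] by (auto simp: d_def)
  then obtain X where X: "\<And>n. J (X n) < d + 1 / real (Suc n)" by metis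
  have par: "(norm (x - y))\<^sup>2 \<le> 2 * (J x - d) + 2 * (J y - d)" for x y
  proof -
    have "(norm (x - y))\<^sup>2 = 2 * J x + 2 * J y - 4 * J ((1/2) *\<^sub>R (x + y))"
      by (simp add: J_def f.add f.scaleR power2_norm_eq_inner inner_add_left inner_add_right
          inner_diff_left inner_diff_right inner_commute algebra_simps)
    with d[of "(1/2) *\<^sub>R (x + y)"] show ?thesis by simp
  qed
  have "Cauchy X"
  proof (rule metric_CauchyI)
    fix e :: real assume e: "e > 0"
    obtain N where N: "4 / e\<^sup>2 < real (Suc N)"
      using reals_Archimedean2[of "4 / e\<^sup>2"] by (metis less_trans lessI of_nat_less_iff)
    have small: "J (X n) - d < e\<^sup>2 / 4" if "n \<ge> N" for n
    proof -
      have "J (X n) - d < 1 / real (Suc n)" using X[of n] by simp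
      also have "\<dots> \<le> 1 / real (Suc N)" using that by (simp add: divide_simps)
      also have "\<dots> < e\<^sup>2 / 4" using N e by (simp add: field_simps)
      finally show ?thesis .
    qed
    have "dist (X m) (X n) < e" if "m \<ge> N" "n \<ge> N" for m n
    proof -
      have "(norm (X m - X n))\<^sup>2 < e\<^sup>2" using par[of "X m" "X n"] small[OF that(1)] small[OF that(2)] by simp
      then show ?thesis using e by (simp add: dist_norm power2_less_imp_less)
    qed
    then show "\<exists>N. \<forall>m\<ge>N. \<forall>n\<ge>N. dist (X m) (X n) < e" by blast
  qed
  then obtain z where z: "X \<longlonglongrightarrow> z" using Cauchy_convergent_iff convergent_def by blast
  have "(\<lambda>n. J (X n)) \<longlonglongrightarrow> J z" unfolding J_def by (intro tendsto_intros z f.tendsto)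
  moreover have "(\<lambda>n. d + 1 / real (Suc n)) \<longlonglongrightarrow> d + 0" by (intro tendsto_intros LIMSEQ_Suc lim_1_over_n)
  ultimately have "J z \<le> d"
    using LIMSEQ_le[of "\<lambda>n. J (X n)" "J z" "\<lambda>n. d + 1 / real (Suc n)" d] X by (auto intro: less_imp_le)
  then have min: "J z \<le> J x" for x using d[of x] by simp
  have "f v = inner z v" for v
  proof -
    define g where "g = inner z v - f v"
    have var: "0 \<le> 2 * s * g + s\<^sup>2 * (norm v)\<^sup>2" for s
    proof -
      have "J (z + s *\<^sub>R v) - J z = 2 * s * g + s\<^sup>2 * (norm v)\<^sup>2"
        unfolding J_def g_def power2_norm_eq_inner
        by (simp add: f.add f.scaleR inner_add_left inner_add_right inner_commute algebra_simps
            power2_eq_square)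
      with min[of "z + s *\<^sub>R v"] show ?thesis by simp
    qed
    show ?thesis
    proof (cases "v = 0")
      case False
      \<comment> \<open>the minimum of the quadratic polynomial in \<open>s\<close>\<close>
      have "0 \<le> - g\<^sup>2 / (norm v)\<^sup>2"
        using var[of "- g / (norm v)\<^sup>2"] False by (simp add: field_simps power2_eq_square)
      then have "g\<^sup>2 \<le> 0" using False by (simp add: field_simps)
      then show ?thesis by (simp add: g_def)
    qed (simp add: f.zero)
  qed
  then show ?thesis using that by blast
qed

lemma riesz:
  fixes f :: "'a::complex_hilbert \<Rightarrow> complex"
  assumes f: "bounded_linear f" and fC: "\<And>c x. f (c *\<^sub>C x) = c * f x"
  obtains z where "\<And>x. f x = cinner x z"
proof -
  obtain z where z: "\<And>x. Re (f x) = inner z x"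
    using riesz_real[OF bounded_linear_compose[OF bounded_linear_Re f]] by metis
  then have Re: "Re (f x) = Re (cinner x z)" for x
    by (metis inner_eq_Re_cinner inner_commute)
  have "f x = cinner x z" for x
  proof (rule complex_eqI[OF Re])
    have "Re (- \<i> * f x) = Re (- \<i> * cinner x z)"
      using Re[of "(- \<i>) *\<^sub>C x"] by (simp only: fC cinner_scaleC_left)
    then show "Im (f x) = Im (cinner x z)" by simp
  qed
  then show ?thesis using that by blast
qed

text \<open>Adjoints are what makes multiplication by a fixed operator weak* continuous: in
  \<open>\<langle>L T R x\<^sub>n, y\<^sub>n\<rangle>\<close> the factor \<open>L\<close> is moved to \<open>y\<^sub>n\<close>.\<close>

lemma bop_adjoint:
  fixes T :: "('a::complex_hilbert, 'b::complex_hilbert) bop"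
  obtains S where "\<And>x y. cinner (bop_apply T x) y = cinner x (bop_apply S y)"
proof -
  have "\<exists>z. \<forall>x. cinner (bop_apply T x) y = cinner x z" for y
    using riesz[of "\<lambda>x. cinner (bop_apply T x) y"]
      bounded_linear_compose[OF cinner.bounded_linear_left bounded_linear_bop]
    by (metis bop_scaleC cinner_scaleC_left)
  then obtain s where s: "\<And>x y. cinner (bop_apply T x) y = cinner x (s y)" by metis
  then have s': "cinner (s y) x = cinner y (bop_apply T x)" for x y
    by (metis cinner_commute)
  obtain K where K: "K > 0" "\<And>x. norm (bop_apply T x) \<le> K * norm x" using bop_norm_bound[of T] by blast
  have bound: "norm (s y) \<le> norm y * K" for y
  proof -
    have "(norm (s y))\<^sup>2 = cmod (cinner (s y) (s y))" by (simp add: cinner_self norm_power)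
    also have "\<dots> \<le> norm y * (K * norm (s y))"
      unfolding s' by (rule order_trans[OF norm_cinner_le]) (simp add: K mult_left_mono)
    finally have "norm (s y) * norm (s y) \<le> (norm y * K) * norm (s y)" by (simp add: power2_eq_square ac_simps)
    then show ?thesis using K(1) by (cases "norm (s y) = 0") auto
  qed
  have "bop_apply (Bop s) = s"
    by (rule bop_apply_Bop[OF _ _ bound]; rule cinner_eqI)
      (simp_all add: s' cinner.add_left cinner_scaleC_left)
  with s show ?thesis using that by metis
qed

section \<open>Normal functionals\<close>

text \<open>\<open>\<phi>\<close> is the pairing with a trace class operator of trace norm at most \<open>c\<close>. Bounding both sums of
  squares by the same \<open>c\<close> is no restriction, since \<open>(s x\<^sub>n, y\<^sub>n / s)\<close> with \<open>s > 0\<close> gives the same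
  functional. The bound is carried along because it is what allows infinite series of functionals to be
  summed.\<close>

definition nuclear_bound ::
  "(('a::complex_hilbert, 'b::complex_hilbert) bop \<Rightarrow> complex) \<Rightarrow> real \<Rightarrow> bool" where
  "nuclear_bound \<phi> c \<longleftrightarrow> (\<exists>x y. square_summable x \<and> square_summable y \<and>
     (\<Sum>n. (norm (x n))\<^sup>2) \<le> c \<and> (\<Sum>n. (norm (y n))\<^sup>2) \<le> c \<and>
     \<phi> = (\<lambda>T. \<Sum>n. cinner (bop_apply T (x n)) (y n)))"

lemma normal_functionals_iff: "\<phi> \<in> normal_functionals \<longleftrightarrow> (\<exists>c. nuclear_bound \<phi> c)"
proof
  assume "\<phi> \<in> normal_functionals"
  then obtain x y where "square_summable x" "square_summable y"
    "\<phi> = (\<lambda>T. \<Sum>n. cinner (bop_apply T (x n)) (y n))"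
    unfolding normal_functionals_def by blast
  then have "nuclear_bound \<phi> (max (\<Sum>n. (norm (x n))\<^sup>2) (\<Sum>n. (norm (y n))\<^sup>2))"
    unfolding nuclear_bound_def using max.cobounded1 max.cobounded2 by blast
  then show "\<exists>c. nuclear_bound \<phi> c" ..
qed (auto simp: nuclear_bound_def normal_functionals_def)

lemma nuclear_bound_mono: "nuclear_bound \<phi> c \<Longrightarrow> c \<le> d \<Longrightarrow> nuclear_bound \<phi> d"
  unfolding nuclear_bound_def by (elim exE conjE, intro exI conjI) (assumption | erule order_trans)+

lemma mult_le_sum_squares: "a * b \<le> a\<^sup>2 + (b\<^sup>2 :: real)"
proof -
  have "2 * (a * b) \<le> a\<^sup>2 + b\<^sup>2" using sum_squares_bound[of a b] by (simp only: mult.assoc)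
  moreover have "0 \<le> a\<^sup>2 + b\<^sup>2" by simp
  ultimately show ?thesis by linarith
qed

lemma norm_cinner_bop_le:
  assumes "\<And>x. norm (bop_apply T x) \<le> K * norm x" "K > 0"
  shows "cmod (cinner (bop_apply T x) y) \<le> K * ((norm x)\<^sup>2 + (norm y)\<^sup>2)"
proof -
  have "cmod (cinner (bop_apply T x) y) \<le> K * norm x * norm y"
    by (rule order_trans[OF norm_cinner_le]) (simp add: assms mult_right_mono)
  also have "\<dots> \<le> K * ((norm x)\<^sup>2 + (norm y)\<^sup>2)"
    using mult_left_mono[OF mult_le_sum_squares[of "norm x" "norm y"], of K] assms(2)
    by (simp add: mult.assoc)
  finally show ?thesis .
qed

lemma summable_norm_cinner_bop:
  assumes "square_summable x" "square_summable y"
  shows "summable (\<lambda>n. norm (cinner (bop_apply T (x n)) (y n)))"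
proof -
  obtain K where K: "K > 0" "\<And>x. norm (bop_apply T x) \<le> K * norm x"
    using bop_norm_bound[of T] by blast
  have "summable (\<lambda>n. K * ((norm (x n))\<^sup>2 + (norm (y n))\<^sup>2))"
    using assms unfolding square_summable_def by (intro summable_mult summable_add)
  then show ?thesis
    by (rule summable_comparison_test'[where N = 0]) (simp add: norm_cinner_bop_le K)
qed

lemmas summable_cinner_bop = summable_norm_cancel[OF summable_norm_cinner_bop]

text \<open>Completeness of the predual in the form in which it is needed: \<open>c\<close> plays the role of a norm. The
  vectors that represent the functionals \<open>\<psi> m\<close> form a double sequence, which is re-indexed along
  \<open>\<nat> \<times> \<nat> \<cong> \<nat>\<close>; absolute summability permits summing it in either order.\<close>

lemma nuclear_bound_suminf:
  assumes \<psi>: "\<And>m. nuclear_bound (\<psi> m) (c m)" and c: "summable c"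
  shows "nuclear_bound (\<lambda>T. \<Sum>m. \<psi> m T) (\<Sum>m. c m)"
proof -
  from \<psi> have "\<forall>m. \<exists>x y. square_summable x \<and> square_summable y \<and>
     (\<Sum>n. (norm (x n))\<^sup>2) \<le> c m \<and> (\<Sum>n. (norm (y n))\<^sup>2) \<le> c m \<and>
     \<psi> m = (\<lambda>T. \<Sum>n. cinner (bop_apply T (x n)) (y n))"
    unfolding nuclear_bound_def by blast
  then obtain x y where xy: "\<And>m. square_summable (x m)" "\<And>m. square_summable (y m)"
      "\<And>m. (\<Sum>n. (norm (x m n))\<^sup>2) \<le> c m" "\<And>m. (\<Sum>n. (norm (y m n))\<^sup>2) \<le> c m"
      "\<And>m. \<psi> m = (\<lambda>T. \<Sum>n. cinner (bop_apply T (x m n)) (y m n))"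
    unfolding choice_iff by blast
  define X where "X i = x (fst (prod_decode i)) (snd (prod_decode i))" for i
  define Y where "Y i = y (fst (prod_decode i)) (snd (prod_decode i))" for i
  have squares: "(\<lambda>(m,n). (norm (z m n))\<^sup>2) summable_on UNIV \<times> UNIV
      \<and> square_summable (\<lambda>i. z (fst (prod_decode i)) (snd (prod_decode i)))
      \<and> (\<Sum>i. (norm (z (fst (prod_decode i)) (snd (prod_decode i))))\<^sup>2) \<le> (\<Sum>m. c m)"
    if z: "\<And>m. square_summable (z m)" "\<And>m. (\<Sum>n. (norm (z m n))\<^sup>2) \<le> c m"
    for z :: "nat \<Rightarrow> nat \<Rightarrow> 'z::complex_hilbert"
  proof -
    define s where "s m = (\<Sum>n. (norm (z m n))\<^sup>2)" for m
    have inner: "((\<lambda>n. (norm (z m n))\<^sup>2) has_sum s m) UNIV" for m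
      using z(1)[of m] unfolding square_summable_def s_def
      by (intro sums_nonneg_imp_has_sum summable_sums) auto
    have s0: "s m \<ge> 0" for m
      using z(1)[of m] unfolding square_summable_def s_def by (intro suminf_nonneg) auto
    have s: "summable s"
      by (rule summable_comparison_test'[OF c]) (use z(2) s0 in \<open>auto simp: s_def\<close>)
    have outer: "(s has_sum (\<Sum>m. s m)) UNIV"
      using s s0 by (intro sums_nonneg_imp_has_sum summable_sums) auto
    have on: "(\<lambda>(m,n). (norm (z m n))\<^sup>2) summable_on UNIV \<times> UNIV"
      by (rule summable_on_SigmaI[where g = s]) (use inner outer in \<open>auto simp: summable_on_def\<close>)
    have "((\<lambda>(m,n). (norm (z m n))\<^sup>2) has_sum (\<Sum>m. s m)) (UNIV \<times> UNIV)"
      by (rule has_sum_SigmaI[OF _ outer on]) (use inner in simp)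
    then have "((\<lambda>i. (\<lambda>(m,n). (norm (z m n))\<^sup>2) (prod_decode i)) has_sum (\<Sum>m. s m)) UNIV"
      by (simp only: has_sum_reindex_bij_betw[OF bij_prod_decode] UNIV_Times_UNIV)
    then have "(\<lambda>i. (norm (z (fst (prod_decode i)) (snd (prod_decode i))))\<^sup>2) sums (\<Sum>m. s m)"
      using has_sum_imp_sums by (simp add: case_prod_unfold)
    moreover have "(\<Sum>m. s m) \<le> (\<Sum>m. c m)"
      by (rule suminf_le[OF _ s c]) (use z(2) in \<open>simp add: s_def\<close>)
    ultimately show ?thesis
      using on unfolding square_summable_def by (simp add: sums_iff)
  qed
  note sx = squares[of x, OF xy(1,3), folded X_def] and sy = squares[of y, OF xy(2,4), folded Y_def]
  have main: "(\<lambda>m. \<psi> m T) sums (\<Sum>i. cinner (bop_apply T (X i)) (Y i))" for T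
  proof -
    obtain K where K: "K > 0" "\<And>x. norm (bop_apply T x) \<le> K * norm x"
      using bop_norm_bound[of T] by blast
    let ?g = "\<lambda>(m,n). cinner (bop_apply T (x m n)) (y m n)"
    have "(\<lambda>p. K * ((\<lambda>(m,n). (norm (x m n))\<^sup>2) p + (\<lambda>(m,n). (norm (y m n))\<^sup>2) p))
        summable_on UNIV \<times> UNIV"
      using sx sy by (intro summable_on_cmult_right summable_on_add) auto
    then have "(\<lambda>p. norm (?g p)) summable_on UNIV \<times> UNIV"
      by (rule Infinite_Sum.abs_summable_on_comparison_test') (auto simp: norm_cinner_bop_le K)
    then have "?g summable_on UNIV \<times> UNIV" by (rule Infinite_Sum.abs_summable_summable)
    then have G: "(?g has_sum infsum ?g (UNIV \<times> UNIV)) (UNIV \<times> UNIV)" by (rule has_sum_infsum)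
    have \<psi>sum: "((\<lambda>m. \<psi> m T) has_sum infsum ?g (UNIV \<times> UNIV)) UNIV"
    proof (rule has_sum_SigmaD[OF G])
      fix m
      show "((\<lambda>n. ?g (m, n)) has_sum \<psi> m T) UNIV"
        using summable_norm_cinner_bop[OF xy(1,2)] summable_sums[OF summable_cinner_bop[OF xy(1,2)]]
        by (simp add: xy(5) norm_summable_imp_has_sum)
    qed
    have "((\<lambda>i. ?g (prod_decode i)) has_sum infsum ?g (UNIV \<times> UNIV)) UNIV"
      using G by (simp only: has_sum_reindex_bij_betw[OF bij_prod_decode] UNIV_Times_UNIV)
    then have "(\<lambda>i. cinner (bop_apply T (X i)) (Y i)) sums infsum ?g (UNIV \<times> UNIV)"
      unfolding X_def Y_def by (simp only: case_prod_unfold has_sum_imp_sums)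
    from sums_unique[OF this] have "infsum ?g (UNIV \<times> UNIV) = (\<Sum>i. cinner (bop_apply T (X i)) (Y i))" .
    with has_sum_imp_sums[OF \<psi>sum] show ?thesis by simp
  qed
  show "nuclear_bound (\<lambda>T. \<Sum>m. \<psi> m T) (\<Sum>m. c m)"
    unfolding nuclear_bound_def sums_unique[OF main, symmetric]
    by (rule exI[of _ X], rule exI[of _ Y]) (use sx sy in simp)
qed

text \<open>The product of the norms, rather than the larger of their squares, is reached by first scaling
  the two vectors to have the same norm.\<close>

lemma nuclear_bound_rank_one: "nuclear_bound (\<lambda>T. cinner (bop_apply T h) g) (norm h * norm g)"
proof -
  have single: "nuclear_bound (\<lambda>T. cinner (bop_apply T h) g) c"
    if "(norm h)\<^sup>2 \<le> c" "(norm g)\<^sup>2 \<le> c" for h :: 'a and g :: 'b and c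
  proof -
    have 1: "(\<lambda>n. (norm (if n = (0::nat) then z else 0))\<^sup>2) sums (norm z)\<^sup>2" for z :: "'z::complex_hilbert"
      using sums_single[of 0 "\<lambda>_. (norm z)\<^sup>2"] by (simp add: if_distrib[of norm] if_distrib[of "\<lambda>x. x\<^sup>2"] cong: if_cong)
    have 2: "(\<lambda>n. cinner (bop_apply T (if n = (0::nat) then h else 0)) (if n = (0::nat) then g else 0))
        sums cinner (bop_apply T h) g" for T
      using sums_single[of 0 "\<lambda>_. cinner (bop_apply T h) g"]
      by (rule back_subst[where P = "\<lambda>f. f sums _"]) (auto simp: bop_zero fun_eq_iff cinner.zero_left)
    show ?thesis unfolding nuclear_bound_def square_summable_def
      by (rule exI[of _ "\<lambda>n. if n = 0 then h else 0"], rule exI[of _ "\<lambda>n. if n = 0 then g else 0"])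
        (use 1[of h] 1[of g] 2 that in \<open>auto simp: sums_iff\<close>)
  qed
  show ?thesis
  proof (cases "h = 0 \<or> g = 0")
    case True
    have "nuclear_bound (\<lambda>T. cinner (bop_apply T (0::'a)) (0::'b)) 0"
      by (rule single) simp_all
    with True show ?thesis by (auto simp: bop_zero cinner.zero_left cinner.zero_right)
  next
    case False
    define s where "s = sqrt (norm g / norm h)"
    have s: "s > 0" "s\<^sup>2 = norm g / norm h" using False by (simp_all add: s_def)
    have "nuclear_bound (\<lambda>T. cinner (bop_apply T (complex_of_real s *\<^sub>C h)) (complex_of_real (1 / s) *\<^sub>C g))
        (norm h * norm g)"
      by (rule single) (use s False in \<open>simp_all add: norm_scaleC power_mult_distrib power2_eq_square
            power_divide norm_divide field_simps\<close>)
    then show ?thesis using s(1) by (simp add: bop_scaleC cinner_scaleC_left cinner_scaleC_right)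
  qed
qed

lemma nuclear_bound_zero: "nuclear_bound (\<lambda>T. 0) 0"
  using nuclear_bound_rank_one[of 0 0] by (simp add: bop_zero cinner.zero_left)

lemma nuclear_bound_add:
  assumes "nuclear_bound \<phi> c" "nuclear_bound \<psi> d"
  shows "nuclear_bound (\<lambda>T. \<phi> T + \<psi> T) (c + d)"
proof -
  define f where "f m = (if m = 0 then \<phi> else if m = 1 then \<psi> else (\<lambda>T. 0))" for m :: nat
  define e where "e m = (if m = 0 then c else if m = 1 then d else 0)" for m :: nat
  have e: "e sums (c + d)" using sums_finite[of "{0,1}" e] by (simp add: e_def)
  have f: "(\<lambda>m. f m T) sums (\<phi> T + \<psi> T)" for T
    using sums_finite[of "{0,1}" "\<lambda>m. f m T"] by (simp add: f_def)
  have "nuclear_bound (f m) (e m)" for m using assms nuclear_bound_zero by (auto simp: f_def e_def)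
  then have "nuclear_bound (\<lambda>T. \<Sum>m. f m T) (\<Sum>m. e m)"
    by (rule nuclear_bound_suminf) (rule sums_summable[OF e])
  then show ?thesis unfolding sums_unique[OF e, symmetric] sums_unique[OF f, symmetric] .
qed

lemma nuclear_bound_sum:
  assumes "finite I" "\<And>i. i \<in> I \<Longrightarrow> nuclear_bound (\<phi> i) (c i)"
  shows "nuclear_bound (\<lambda>T. \<Sum>i\<in>I. \<phi> i T) (\<Sum>i\<in>I. c i)"
  using assms
proof (induction I)
  case (insert i I)
  then have "nuclear_bound (\<lambda>T. \<phi> i T + (\<Sum>i\<in>I. \<phi> i T)) (c i + (\<Sum>i\<in>I. c i))"
    by (intro nuclear_bound_add) simp_all
  with insert.hyps show ?case by simp
qed (simp add: nuclear_bound_zero)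

lemma normal_rank_one: "(\<lambda>T. cinner (bop_apply T h) g) \<in> normal_functionals"
  unfolding normal_functionals_iff by (rule exI, rule nuclear_bound_rank_one)

lemma normal_zero: "(\<lambda>T. 0) \<in> normal_functionals"
  unfolding normal_functionals_iff by (rule exI, rule nuclear_bound_zero)

lemma normal_add:
  "\<phi> \<in> normal_functionals \<Longrightarrow> \<psi> \<in> normal_functionals \<Longrightarrow> (\<lambda>T. \<phi> T + \<psi> T) \<in> normal_functionals"
  unfolding normal_functionals_iff by (elim exE) (rule exI, rule nuclear_bound_add)

lemma normal_suminf:
  assumes "\<And>m. nuclear_bound (\<psi> m) (c m)" "summable c"
  shows "(\<lambda>T. \<Sum>m. \<psi> m T) \<in> normal_functionals"
  unfolding normal_functionals_iff by (rule exI, rule nuclear_bound_suminf) (rule assms)+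

lemma normal_functionalsE:
  assumes "\<phi> \<in> normal_functionals"
  obtains x y where "square_summable x" "square_summable y"
    "\<And>T. \<phi> T = (\<Sum>n. cinner (bop_apply T (x n)) (y n))"
  using assms that unfolding normal_functionals_def by (elim CollectE exE conjE) simp

lemma normal_functionalsI:
  assumes "square_summable x" "square_summable y"
    "\<And>T. \<phi> T = (\<Sum>n. cinner (bop_apply T (x n)) (y n))"
  shows "\<phi> \<in> normal_functionals"
proof -
  have "\<phi> = (\<lambda>T. \<Sum>n. cinner (bop_apply T (x n)) (y n))" using assms(3) by (rule ext)
  with assms(1,2) show ?thesis unfolding normal_functionals_def by blast
qed

lemma square_summable_bop:
  assumes "square_summable x" shows "square_summable (\<lambda>n. bop_apply T (x n))"
proof -
  obtain K where K: "K > 0" "\<And>x. norm (bop_apply T x) \<le> K * norm x"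
    using bop_norm_bound[of T] by blast
  have le: "(norm (bop_apply T z))\<^sup>2 \<le> K\<^sup>2 * (norm z)\<^sup>2" for z
    using power_mono[OF K(2)[of z], of 2] by (simp add: power_mult_distrib)
  have "summable (\<lambda>n. K\<^sup>2 * (norm (x n))\<^sup>2)"
    using assms unfolding square_summable_def by (rule summable_mult)
  then show ?thesis
    unfolding square_summable_def by (rule summable_comparison_test'[where N = 0]) (simp add: le)
qed

lemma normal_scale:
  assumes "\<phi> \<in> normal_functionals" shows "(\<lambda>T. a * \<phi> T) \<in> normal_functionals"
proof -
  from assms obtain x y where xy: "square_summable x" "square_summable y"
    "\<And>T. \<phi> T = (\<Sum>n. cinner (bop_apply T (x n)) (y n))" by (rule normal_functionalsE) blast
  show ?thesis
  proof (rule normal_functionalsI)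
    show "square_summable (\<lambda>n. a *\<^sub>C x n)"
      using xy(1) unfolding square_summable_def norm_scaleC power_mult_distrib by (rule summable_mult)
    show "a * \<phi> T = (\<Sum>n. cinner (bop_apply T (a *\<^sub>C x n)) (y n))" for T
      by (simp add: xy(3) bop_scaleC cinner_scaleC_left suminf_mult[OF summable_cinner_bop[OF xy(1,2)]])
  qed (rule xy)
qed

lemma normal_diff:
  assumes "\<phi> \<in> normal_functionals" "\<psi> \<in> normal_functionals"
  shows "(\<lambda>T. \<phi> T - \<psi> T) \<in> normal_functionals"
  using normal_add[OF assms(1) normal_scale[OF assms(2), of "-1"]] by simp

lemma normal_linear:
  assumes "\<phi> \<in> normal_functionals"
  shows "\<phi> (S + T) = \<phi> S + \<phi> T" "\<phi> (c *\<^sub>C T) = c * \<phi> T"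
proof -
  from assms obtain x y where xy: "square_summable x" "square_summable y"
    "\<And>T. \<phi> T = (\<Sum>n. cinner (bop_apply T (x n)) (y n))" by (rule normal_functionalsE) blast
  note s = summable_cinner_bop[OF xy(1,2)]
  show "\<phi> (S + T) = \<phi> S + \<phi> T"
    by (simp add: xy(3) plus_bop.rep_eq cinner.add_left suminf_add[OF s s])
  show "\<phi> (c *\<^sub>C T) = c * \<phi> T"
    by (simp add: xy(3) scaleC_bop.rep_eq cinner_scaleC_left suminf_mult[OF s])
qed

lemma normal_compose:
  assumes "\<phi> \<in> normal_functionals"
  shows "(\<lambda>T. \<phi> (L \<cdot> T \<cdot> R)) \<in> normal_functionals"
proof -
  from assms obtain x y where xy: "square_summable x" "square_summable y"
    "\<And>T. \<phi> T = (\<Sum>n. cinner (bop_apply T (x n)) (y n))" by (rule normal_functionalsE) blast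
  obtain L' where L': "\<And>x y. cinner (bop_apply L x) y = cinner x (bop_apply L' y)"
    using bop_adjoint[of L] by blast
  show ?thesis
    by (rule normal_functionalsI[of "\<lambda>n. bop_apply R (x n)" "\<lambda>n. bop_apply L' (y n)"])
      (simp_all add: square_summable_bop xy bop_comp.rep_eq L')
qed

section \<open>Annihilators and the weak* topology\<close>

lemma openin_weak_star_vimage:
  "\<phi> \<in> normal_functionals \<Longrightarrow> open G \<Longrightarrow> openin weak_star (\<phi> -` G)"
  unfolding weak_star_def by (rule topology_generated_by_Basis) blast

lemma topspace_weak_star [simp]: "topspace weak_star = UNIV"
  using openin_subset[OF openin_weak_star_vimage[OF normal_zero open_UNIV]] by auto

lemma continuous_map_normal:
  "\<phi> \<in> normal_functionals \<Longrightarrow> continuous_map weak_star euclidean \<phi>"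
  unfolding continuous_map_def using openin_weak_star_vimage[of \<phi>]
  by (auto simp: vimage_def)

lemma continuous_map_into_weak_star:
  fixes f :: "'x \<Rightarrow> ('a::complex_hilbert, 'b::complex_hilbert) bop"
  assumes "\<And>\<phi>. \<phi> \<in> normal_functionals \<Longrightarrow> continuous_map X euclidean (\<lambda>x. \<phi> (f x))"
  shows "continuous_map X weak_star f"
  unfolding weak_star_def
proof (rule continuous_on_generated_topo)
  fix W :: "('a, 'b) bop set"
  assume "W \<in> {\<phi> -` G | \<phi> G. \<phi> \<in> normal_functionals \<and> open G}"
  then obtain \<phi> G where W: "W = \<phi> -` G" "\<phi> \<in> normal_functionals" "open G" by blast
  have "f -` W \<inter> topspace X = {x \<in> topspace X. \<phi> (f x) \<in> G}" using W(1) by auto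
  then show "openin X (f -` W \<inter> topspace X)"
    using assms[OF W(2)] W(3) unfolding continuous_map_def by auto
next
  show "f ` topspace X \<subseteq> \<Union> {\<phi> -` G | \<phi> G. \<phi> \<in> normal_functionals \<and> open G}"
    using topspace_weak_star[where ?'a = 'a and ?'b = 'b]
    unfolding weak_star_def topology_generated_by_topspace by simp
qed

lemma weak_star_neighbourhood:
  assumes "openin weak_star W" "T \<in> W"
  shows "\<exists>\<Phi> e. finite \<Phi> \<and> \<Phi> \<subseteq> normal_functionals \<and> e > 0 \<and>
    (\<forall>S. (\<forall>\<phi>\<in>\<Phi>. cmod (\<phi> S - \<phi> T) < e) \<longrightarrow> S \<in> W)"
proof -
  from assms(1) have "generate_topology_on {\<phi> -` G | \<phi> G. \<phi> \<in> normal_functionals \<and> open G} W"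
    unfolding weak_star_def by (rule openin_topology_generated_by)
  then show ?thesis using assms(2)
  proof (induction)
    case Empty
    then show ?case by simp
  next
    case (Int V W)
    obtain \<Phi> d where \<Phi>: "finite \<Phi>" "\<Phi> \<subseteq> normal_functionals" "d > 0"
      "\<forall>S. (\<forall>\<phi>\<in>\<Phi>. cmod (\<phi> S - \<phi> T) < d) \<longrightarrow> S \<in> V"
      using Int.IH(1)[OF IntD1[OF Int.prems]] by (elim exE conjE)
    obtain \<Psi> e where \<Psi>: "finite \<Psi>" "\<Psi> \<subseteq> normal_functionals" "e > 0"
      "\<forall>S. (\<forall>\<phi>\<in>\<Psi>. cmod (\<phi> S - \<phi> T) < e) \<longrightarrow> S \<in> W"
      using Int.IH(2)[OF IntD2[OF Int.prems]] by (elim exE conjE)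
    show ?case
      by (rule exI[of _ "\<Phi> \<union> \<Psi>"], rule exI[of _ "min d e"]) (use \<Phi> \<Psi> in simp)
  next
    case (UN \<W>)
    then obtain W where "W \<in> \<W>" "T \<in> W" by blast
    from UN.IH[OF this] obtain \<Phi> e where \<Phi>: "finite \<Phi>" "\<Phi> \<subseteq> normal_functionals" "e > 0"
      "\<forall>S. (\<forall>\<phi>\<in>\<Phi>. cmod (\<phi> S - \<phi> T) < e) \<longrightarrow> S \<in> W" by (elim exE conjE)
    show ?case
      by (rule exI[of _ \<Phi>], rule exI[of _ e]) (use \<Phi> \<open>W \<in> \<W>\<close> in auto)
  next
    case (Basis W)
    then obtain \<phi> G where W: "W = \<phi> -` G" "\<phi> \<in> normal_functionals" "open G" by blast
    then obtain e where "e > 0" "\<And>z. dist z (\<phi> T) < e \<Longrightarrow> z \<in> G"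
      using Basis.prems unfolding open_dist by auto
    with W show ?case by (intro exI[of _ "{\<phi>}"] exI[of _ e]) (simp add: dist_norm)
  qed
qed

lemma normal_closure_zero:
  assumes "T \<in> weak_star closure_of M" "\<phi> \<in> normal_functionals" "\<And>S. S \<in> M \<Longrightarrow> \<phi> S = 0"
  shows "\<phi> T = 0"
proof -
  have "closedin weak_star {S \<in> topspace weak_star. \<phi> S \<in> {0}}"
    by (rule closedin_continuous_map_preimage[OF continuous_map_normal[OF assms(2)]]) simp
  then have "weak_star closure_of M \<subseteq> {S \<in> topspace weak_star. \<phi> S \<in> {0}}"
    by (rule closure_of_minimal[rotated]) (use assms(3) in auto)
  with assms(1) show ?thesis by blast
qed

lemma normal_vector_space:
  assumes "\<phi> \<in> normal_functionals"
  shows "\<phi> 0 = 0" "\<phi> (S - T) = \<phi> S - \<phi> T"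
proof -
  show "\<phi> 0 = 0" using normal_linear(2)[OF assms, of 0 0] by (simp add: complex_vector.scale_zero_right)
  show "\<phi> (S - T) = \<phi> S - \<phi> T" using normal_linear(1)[OF assms, of "S - T" T] by simp
qed

lemma normal_cspan_zero:
  assumes "T \<in> cspan G" "\<phi> \<in> normal_functionals" "\<And>S. S \<in> G \<Longrightarrow> \<phi> S = 0"
  shows "\<phi> T = 0"
  using assms(1)
proof (rule complex_vector.span_induct)
  show "csubspace {S. \<phi> S = 0}"
    by (simp add: complex_vector.subspace_def normal_vector_space[OF assms(2)] normal_linear[OF assms(2)])
qed (rule assms(3))

text \<open>By induction on \<open>\<Phi>\<close>: either \<open>\<phi>\<close> vanishes on \<open>M\<close>, hence at \<open>T\<close>, or \<open>\<phi>\<close> can be normalised at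
  some \<open>m\<^sub>0 \<in> M\<close>, and the induction hypothesis is applied to the kernel of \<open>\<phi>\<close> in \<open>M\<close> and to the
  component \<open>T - \<phi> T m\<^sub>0\<close> of \<open>T\<close>.\<close>

lemma normal_interpolation:
  assumes "finite \<Phi>" "\<Phi> \<subseteq> normal_functionals" "csubspace M"
    and "\<And>\<theta>. \<theta> \<in> normal_functionals \<Longrightarrow> (\<And>S. S \<in> M \<Longrightarrow> \<theta> S = 0) \<Longrightarrow> \<theta> T = 0"
  shows "\<exists>S\<in>M. \<forall>\<phi>\<in>\<Phi>. \<phi> S = \<phi> T"
  using assms
proof (induction \<Phi> arbitrary: M T)
  case empty
  then show ?case using complex_vector.subspace_0 by blast
next
  case (insert \<phi> \<Phi>)
  have \<phi>: "\<phi> \<in> normal_functionals" and \<Phi>: "\<Phi> \<subseteq> normal_functionals" using insert.prems by auto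
  show ?case
  proof (cases "\<forall>S\<in>M. \<phi> S = 0")
    case True
    then have "\<phi> T = 0" using insert.prems(3)[OF \<phi>] by simp
    moreover have "\<exists>S\<in>M. \<forall>\<phi>\<in>\<Phi>. \<phi> S = \<phi> T"
      by (rule insert.IH[OF \<Phi> insert.prems(2)]) (rule insert.prems(3))
    ultimately show ?thesis using True by auto
  next
    case False
    then obtain m1 where m1: "m1 \<in> M" "\<phi> m1 \<noteq> 0" by blast
    define m0 where "m0 = (1 / \<phi> m1) *\<^sub>C m1"
    have m0: "m0 \<in> M" "\<phi> m0 = 1"
      using m1 insert.prems(2) by (simp_all add: m0_def complex_vector.subspace_scale normal_linear[OF \<phi>])
    define M' where "M' = {S \<in> M. \<phi> S = 0}"
    define T' where "T' = T - \<phi> T *\<^sub>C m0"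
    have sub: "S - \<phi> S *\<^sub>C m0 \<in> M'" if "S \<in> M" for S
      using that insert.prems(2) m0 unfolding M'_def
      by (simp add: complex_vector.subspace_diff complex_vector.subspace_scale
          normal_vector_space[OF \<phi>] normal_linear[OF \<phi>])
    have "\<exists>S\<in>M'. \<forall>\<psi>\<in>\<Phi>. \<psi> S = \<psi> T'"
    proof (rule insert.IH[OF \<Phi>])
      show "csubspace M'"
        using insert.prems(2) unfolding M'_def complex_vector.subspace_def
        by (simp add: normal_vector_space[OF \<phi>] normal_linear[OF \<phi>])
      fix \<theta> :: "('a, 'b) bop \<Rightarrow> complex"
      assume \<theta>: "\<theta> \<in> normal_functionals" "\<And>S. S \<in> M' \<Longrightarrow> \<theta> S = 0"
      have "(\<lambda>S. \<theta> S - \<theta> m0 * \<phi> S) \<in> normal_functionals"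
        by (intro normal_diff normal_scale \<theta> \<phi>)
      moreover have "\<theta> S - \<theta> m0 * \<phi> S = 0" if "S \<in> M" for S
        using \<theta>(2)[OF sub[OF that]] by (simp add: normal_vector_space[OF \<theta>(1)] normal_linear[OF \<theta>(1)])
      ultimately have "\<theta> T - \<theta> m0 * \<phi> T = 0" by (rule insert.prems(3))
      then show "\<theta> T' = 0" by (simp add: T'_def normal_vector_space[OF \<theta>(1)] normal_linear[OF \<theta>(1)])
    qed
    then obtain S where S: "S \<in> M'" "\<And>\<psi>. \<psi> \<in> \<Phi> \<Longrightarrow> \<psi> S = \<psi> T'" by blast
    have "S + \<phi> T *\<^sub>C m0 \<in> M"
      using S(1) insert.prems(2) m0
      by (simp add: M'_def complex_vector.subspace_add complex_vector.subspace_scale)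
    moreover have "\<phi> (S + \<phi> T *\<^sub>C m0) = \<phi> T"
      using S(1) m0 by (simp add: M'_def normal_linear[OF \<phi>])
    moreover have "\<psi> (S + \<phi> T *\<^sub>C m0) = \<psi> T" if "\<psi> \<in> \<Phi>" for \<psi>
    proof -
      have \<psi>: "\<psi> \<in> normal_functionals" using that \<Phi> by blast
      show ?thesis
        using S(2)[OF that] by (simp add: T'_def normal_vector_space[OF \<psi>] normal_linear[OF \<psi>])
    qed
    ultimately show ?thesis by blast
  qed
qed

text \<open>The bipolar theorem for subspaces. A weak* neighbourhood involves only finitely many normal
  functionals, so that interpolation by an element of the span replaces the Hahn-Banach theorem.
  Every later statement about a weak* closed span is checked on generators through this criterion.\<close>

theorem weak_star_closure_cspan_iff:
  "T \<in> weak_star closure_of cspan G \<longleftrightarrow>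
     (\<forall>\<phi>\<in>normal_functionals. (\<forall>S\<in>G. \<phi> S = 0) \<longrightarrow> \<phi> T = 0)"
proof
  assume T: "T \<in> weak_star closure_of cspan G"
  show "\<forall>\<phi>\<in>normal_functionals. (\<forall>S\<in>G. \<phi> S = 0) \<longrightarrow> \<phi> T = 0"
  proof (intro ballI impI)
    fix \<phi> :: "('a, 'b) bop \<Rightarrow> complex"
    assume \<phi>: "\<phi> \<in> normal_functionals" "\<forall>S\<in>G. \<phi> S = 0"
    show "\<phi> T = 0"
      by (rule normal_closure_zero[OF T \<phi>(1)], erule normal_cspan_zero[OF _ \<phi>(1)]) (use \<phi>(2) in blast)
  qed
next
  assume ann: "\<forall>\<phi>\<in>normal_functionals. (\<forall>S\<in>G. \<phi> S = 0) \<longrightarrow> \<phi> T = 0"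
  show "T \<in> weak_star closure_of cspan G"
    unfolding in_closure_of
  proof (intro conjI allI impI)
    fix W assume W: "T \<in> W \<and> openin weak_star W"
    obtain \<Phi> e where \<Phi>: "finite \<Phi>" "\<Phi> \<subseteq> normal_functionals" "e > 0"
        "\<forall>S. (\<forall>\<phi>\<in>\<Phi>. cmod (\<phi> S - \<phi> T) < e) \<longrightarrow> S \<in> W"
      using weak_star_neighbourhood[OF conjunct2[OF W] conjunct1[OF W]] by (elim exE conjE)
    have "\<exists>S\<in>cspan G. \<forall>\<phi>\<in>\<Phi>. \<phi> S = \<phi> T"
    proof (rule normal_interpolation[OF \<Phi>(1,2) complex_vector.subspace_span])
      fix \<theta> assume \<theta>: "\<theta> \<in> normal_functionals" "\<And>S. S \<in> cspan G \<Longrightarrow> \<theta> S = 0"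
      have "\<forall>S\<in>G. \<theta> S = 0" using \<theta>(2) complex_vector.span_base by blast
      then show "\<theta> T = 0" using ann \<theta>(1) by simp
    qed
    then obtain S where S: "S \<in> cspan G" "\<forall>\<phi>\<in>\<Phi>. \<phi> S = \<phi> T" by blast
    have "cmod (\<phi> S - \<phi> T) < e" if "\<phi> \<in> \<Phi>" for \<phi>
      unfolding bspec[OF S(2) that] using \<Phi>(3) by simp
    then have "S \<in> W" using \<Phi>(4) by blast
    with S(1) show "\<exists>S. S \<in> cspan G \<and> S \<in> W" by blast
  qed simp
qed

lemma weak_star_closed_subspaceI:
  assumes "weak_star_closed_subspace U"
    and "\<And>\<phi>. \<phi> \<in> normal_functionals \<Longrightarrow> (\<And>S. S \<in> U \<Longrightarrow> \<phi> S = 0) \<Longrightarrow> \<phi> T = 0"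
  shows "T \<in> U"
proof -
  have U: "cspan U = U" "weak_star closure_of U = U"
    using assms(1) unfolding weak_star_closed_subspace_def
    by (simp_all add: complex_vector.span_eq_iff closure_of_closedin)
  have "T \<in> weak_star closure_of cspan U"
    unfolding weak_star_closure_cspan_iff
  proof (intro ballI impI)
    fix \<phi> assume "\<phi> \<in> normal_functionals" "\<forall>S\<in>U. \<phi> S = 0"
    then show "\<phi> T = 0" by (intro assms(2)[of \<phi>]) blast+
  qed
  then show ?thesis unfolding U .
qed

text \<open>Induction on \<open>\<Phi>\<close> as for interpolation: a functional that agrees with \<open>\<omega>\<close> on the kernel of
  \<open>\<phi>\<close> in \<open>V\<close> is corrected by the multiple of \<open>\<phi>\<close> that makes it right at \<open>m\<^sub>0\<close>.\<close>

lemma linear_on_kernel_eq_normal: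
  assumes "finite \<Phi>" "\<Phi> \<subseteq> normal_functionals" "csubspace V" "clinear_on V \<omega>"
    and "\<And>S. S \<in> V \<Longrightarrow> (\<And>\<phi>. \<phi> \<in> \<Phi> \<Longrightarrow> \<phi> S = 0) \<Longrightarrow> \<omega> S = 0"
  shows "\<exists>\<theta>\<in>normal_functionals. \<forall>S\<in>V. \<omega> S = \<theta> S"
  using assms
proof (induction \<Phi> arbitrary: V)
  case empty
  then show ?case using normal_zero by auto
next
  case (insert \<phi> \<Phi>)
  have \<phi>: "\<phi> \<in> normal_functionals" and \<Phi>: "\<Phi> \<subseteq> normal_functionals" using insert.prems by auto
  show ?case
  proof (cases "\<forall>S\<in>V. \<phi> S = 0")
    case True
    show ?thesis
    proof (rule insert.IH[OF \<Phi> insert.prems(2,3)])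
      show "\<omega> S = 0" if "S \<in> V" "\<And>\<psi>. \<psi> \<in> \<Phi> \<Longrightarrow> \<psi> S = 0" for S
        using insert.prems(4)[of S] that True by blast
    qed
  next
    case False
    then obtain m1 where m1: "m1 \<in> V" "\<phi> m1 \<noteq> 0" by blast
    define m0 where "m0 = (1 / \<phi> m1) *\<^sub>C m1"
    have m0: "m0 \<in> V" "\<phi> m0 = 1"
      using m1 insert.prems(2) by (simp_all add: m0_def complex_vector.subspace_scale normal_linear[OF \<phi>])
    define V' where "V' = {S \<in> V. \<phi> S = 0}"
    have "\<exists>\<theta>\<in>normal_functionals. \<forall>S\<in>V'. \<omega> S = \<theta> S"
    proof (rule insert.IH[OF \<Phi>])
      show "csubspace V'"
        using insert.prems(2) unfolding V'_def complex_vector.subspace_def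
        by (simp add: normal_vector_space[OF \<phi>] normal_linear[OF \<phi>])
      show "clinear_on V' \<omega>" using insert.prems(3) unfolding clinear_on_def V'_def by blast
      show "\<omega> S = 0" if "S \<in> V'" "\<And>\<psi>. \<psi> \<in> \<Phi> \<Longrightarrow> \<psi> S = 0" for S
        using insert.prems(4)[of S] that unfolding V'_def by blast
    qed
    then obtain \<theta> where \<theta>: "\<theta> \<in> normal_functionals" "\<And>S. S \<in> V' \<Longrightarrow> \<omega> S = \<theta> S" by blast
    define \<theta>' where "\<theta>' S = \<theta> S + (\<omega> m0 - \<theta> m0) * \<phi> S" for S
    have "\<theta>' \<in> normal_functionals" unfolding \<theta>'_def by (intro normal_add normal_scale \<theta> \<phi>)
    moreover have "\<omega> S = \<theta>' S" if S: "S \<in> V" for S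
    proof -
      have 1: "S - \<phi> S *\<^sub>C m0 \<in> V'"
        using S insert.prems(2) m0 unfolding V'_def
        by (simp add: complex_vector.subspace_diff complex_vector.subspace_scale
            normal_vector_space[OF \<phi>] normal_linear[OF \<phi>])
      then have "\<omega> S = \<omega> (S - \<phi> S *\<^sub>C m0) + \<omega> (\<phi> S *\<^sub>C m0)"
        using insert.prems(2,3) m0(1) complex_vector.subspace_scale[of V m0 "\<phi> S"]
        unfolding clinear_on_def V'_def by (metis (mono_tags, lifting) diff_add_cancel mem_Collect_eq)
      also have "\<omega> (\<phi> S *\<^sub>C m0) = \<phi> S * \<omega> m0"
        using insert.prems(3) m0(1) by (simp add: clinear_on_def scaleC_complex_def)
      finally show ?thesis
        unfolding \<theta>(2)[OF 1] by (simp add: \<theta>'_def normal_vector_space[OF \<theta>(1)]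
            normal_linear[OF \<theta>(1)] algebra_simps)
    qed
    ultimately show ?thesis by blast
  qed
qed

text \<open>Continuity at \<open>0\<close> bounds \<open>\<omega>\<close> on \<open>V\<close> by finitely many normal functionals; it therefore vanishes
  on their common kernel.\<close>

theorem predual_eq_normal:
  assumes V: "csubspace V" and \<omega>: "\<omega> \<in> predual V"
  obtains \<phi> where "\<phi> \<in> normal_functionals" "\<And>S. S \<in> V \<Longrightarrow> \<omega> S = \<phi> S"
proof -
  have lin: "clinear_on V \<omega>" and cont: "continuous_map (subtopology weak_star V) euclidean \<omega>"
    using \<omega> by (auto simp: predual_def)
  have scale: "\<omega> (c *\<^sub>C S) = c * \<omega> S" if "S \<in> V" for c S
    using lin that by (simp add: clinear_on_def scaleC_complex_def)
  have V0: "0 \<in> V" using V by (rule complex_vector.subspace_0)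
  have \<omega>0: "\<omega> 0 = 0" using scale[OF V0, of 0] by (simp add: complex_vector.scale_zero_right)
  have "openin (subtopology weak_star V) {S \<in> topspace (subtopology weak_star V). \<omega> S \<in> ball 0 1}"
    by (rule openin_continuous_map_preimage[OF cont]) simp
  then have "\<exists>W. openin weak_star W \<and> {S \<in> V. \<omega> S \<in> ball 0 1} = W \<inter> V"
    unfolding openin_subtopology topspace_subtopology topspace_weak_star Int_UNIV_left .
  then obtain W where W: "openin weak_star W" and WV: "{S \<in> V. \<omega> S \<in> ball 0 1} = W \<inter> V"
    by blast
  have "0 \<in> {S \<in> V. \<omega> S \<in> ball 0 1}" using V0 \<omega>0 by simp
  then have "0 \<in> W" unfolding WV by (rule IntD1)
  then obtain \<Phi> e where \<Phi>: "finite \<Phi>" "\<Phi> \<subseteq> normal_functionals" "e > 0"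
      "\<forall>S. (\<forall>\<phi>\<in>\<Phi>. cmod (\<phi> S - \<phi> 0) < e) \<longrightarrow> S \<in> W"
    using weak_star_neighbourhood[OF W \<open>0 \<in> W\<close>] by (elim exE conjE)
  have "\<omega> S = 0" if S: "S \<in> V" "\<And>\<phi>. \<phi> \<in> \<Phi> \<Longrightarrow> \<phi> S = 0" for S
  proof (rule ccontr)
    assume ne: "\<omega> S \<noteq> 0"
    define S' where "S' = (1 / \<omega> S) *\<^sub>C S"
    have "S' \<in> V" unfolding S'_def using V S(1) by (rule complex_vector.subspace_scale)
    moreover have "\<phi> S' - \<phi> 0 = 0" if "\<phi> \<in> \<Phi>" for \<phi>
    proof -
      have \<phi>: "\<phi> \<in> normal_functionals" using \<Phi>(2) that by blast
      show ?thesis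
        using S(2)[OF that] by (simp add: S'_def normal_linear[OF \<phi>] normal_vector_space[OF \<phi>])
    qed
    then have "cmod (\<phi> S' - \<phi> 0) < e" if "\<phi> \<in> \<Phi>" for \<phi>
      using that \<Phi>(3) by (metis norm_zero)
    then have "S' \<in> W" using \<Phi>(4) by blast
    ultimately have "S' \<in> {S \<in> V. \<omega> S \<in> ball 0 1}" unfolding WV by (rule IntI[rotated])
    then have "\<omega> S' \<in> ball 0 1" by simp
    moreover have "\<omega> S' = 1" using ne by (simp add: S'_def scale[OF S(1)])
    ultimately show False by simp
  qed
  then have "\<exists>\<theta>\<in>normal_functionals. \<forall>S\<in>V. \<omega> S = \<theta> S"
    by (rule linear_on_kernel_eq_normal[OF \<Phi>(1,2) V lin])
  then obtain \<theta> where "\<theta> \<in> normal_functionals" "\<forall>S\<in>V. \<omega> S = \<theta> S" by (elim bexE)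
  then show ?thesis by (intro that[of \<theta>]) simp_all
qed

lemma normal_in_predual:
  assumes "\<phi> \<in> normal_functionals" shows "\<phi> \<in> predual V"
  unfolding predual_def clinear_on_def
  by (simp add: normal_linear[OF assms] scaleC_complex_def continuous_map_from_subtopology
      continuous_map_normal[OF assms])

section \<open>Tensor products of operators\<close>

definition orthonormal :: "'a::complex_hilbert set \<Rightarrow> bool" where
  "orthonormal E \<longleftrightarrow> (\<forall>e\<in>E. \<forall>e'\<in>E. cinner e e' = (if e = e' then 1 else 0))"

lemma gram_schmidt:
  fixes F :: "'a::complex_hilbert set"
  assumes "finite F"
  shows "\<exists>E. finite E \<and> orthonormal E \<and> (\<forall>k\<in>F. k = (\<Sum>e\<in>E. cinner k e *\<^sub>C e))"
  using assms
proof (induction F)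
  case empty
  show ?case by (rule exI[of _ "{}"]) (simp add: orthonormal_def)
next
  case (insert k F)
  then obtain E where E: "finite E" "orthonormal E" "\<And>k. k \<in> F \<Longrightarrow> k = (\<Sum>e\<in>E. cinner k e *\<^sub>C e)"
    by blast
  define r where "r = k - (\<Sum>e\<in>E. cinner k e *\<^sub>C e)"
  have orth: "cinner (\<Sum>e\<in>E. c e *\<^sub>C e) e' = c e'" if "e' \<in> E" for c e'
  proof -
    have "cinner (\<Sum>e\<in>E. c e *\<^sub>C e) e' = (\<Sum>e\<in>E. if e = e' then c e else 0)"
      unfolding cinner.sum_left cinner_scaleC_left
      by (rule sum.cong) (use E(2) that in \<open>auto simp: orthonormal_def\<close>)
    then show ?thesis using E(1) that by simp
  qed
  have r: "cinner r e = 0" if "e \<in> E" for e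
    unfolding r_def cinner.diff_left orth[OF that] by simp
  show ?case
  proof (cases "r = 0")
    case True
    then have "k = (\<Sum>e\<in>E. cinner k e *\<^sub>C e)" by (simp add: r_def)
    with E show ?thesis by (intro exI[of _ E]) blast
  next
    case False
    define e0 where "e0 = complex_of_real (1 / norm r) *\<^sub>C r"
    have e0: "cinner e0 e0 = 1"
      unfolding cinner_self using False by (simp add: e0_def norm_scaleC norm_divide)
    have e0E: "cinner e0 e = 0" "cinner e e0 = 0" if "e \<in> E" for e
    proof -
      show "cinner e0 e = 0" using r[OF that] by (simp add: e0_def cinner_scaleC_left)
      then show "cinner e e0 = 0" by (metis cinner_commute complex_cnj_zero)
    qed
    have "e0 \<notin> E" using e0 e0E by force
    have sum0: "cinner (\<Sum>e\<in>E. c e *\<^sub>C e) e0 = 0" for c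
      unfolding cinner.sum_left cinner_scaleC_left using e0E by (simp add: sum.neutral)
    show ?thesis
    proof (intro exI[of _ "insert e0 E"] conjI ballI)
      show "finite (insert e0 E)" using E(1) by simp
      show "orthonormal (insert e0 E)" using E(2) e0 e0E \<open>e0 \<notin> E\<close> by (auto simp: orthonormal_def)
      fix k' assume "k' \<in> insert k F"
      then consider "k' = k" | "k' \<in> F" by blast
      then show "k' = (\<Sum>e\<in>insert e0 E. cinner k' e *\<^sub>C e)"
      proof cases
        case 1
        have "cinner k e0 = cinner r e0" using sum0 by (simp add: r_def cinner.diff_left)
        also have "\<dots> = complex_of_real (norm r)"
          using False by (simp add: e0_def cinner_scaleC_right cinner_self power2_eq_square)
        finally have "cinner k e0 *\<^sub>C e0 = r" using False by (simp add: e0_def scaleC_scaleC scaleC_one)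
        then show ?thesis using E(1) \<open>e0 \<notin> E\<close> by (simp add: 1 r_def)
      next
        case 2
        have "cinner k' e0 = 0" using sum0[of "cinner k'"] E(3)[OF 2, symmetric] by simp
        then show ?thesis
          using E(1) \<open>e0 \<notin> E\<close> E(3)[OF 2, symmetric] by simp
      qed
    qed
  qed
qed

text \<open>The extension by continuity is read off from a relation instead of a function: the bound shows that
  the relation is single valued, so that well-definedness on a span of tensors needs no separate proof.\<close>

lemma bounded_extension:
  fixes G :: "('a::complex_hilbert \<times> 'b::complex_hilbert) set"
  assumes add: "\<And>u v u' v'. (u, v) \<in> G \<Longrightarrow> (u', v') \<in> G \<Longrightarrow> (u + u', v + v') \<in> G"
    and scale: "\<And>c u v. (u, v) \<in> G \<Longrightarrow> (c *\<^sub>C u, c *\<^sub>C v) \<in> G"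
    and bound: "\<And>u v. (u, v) \<in> G \<Longrightarrow> norm v \<le> C * norm u"
    and dense: "closure (fst ` G) = UNIV"
  shows "\<exists>W. \<forall>u v. (u, v) \<in> G \<longrightarrow> bop_apply W u = v"
proof -
  have diff: "(u - u', v - v') \<in> G" if "(u, v) \<in> G" "(u', v') \<in> G" for u v u' v'
    using add[OF that(1) scale[OF that(2), of "-1"]] by (simp add: complex_vector.scale_minus_left scaleC_one)
  define L where "L u w \<longleftrightarrow> (\<exists>a b. (\<forall>n::nat. (a n, b n) \<in> G) \<and> a \<longlonglongrightarrow> u \<and> b \<longlonglongrightarrow> w)" for u w
  have L_add: "L (u + u') (w + w')" if "L u w" "L u' w'" for u w u' w'
  proof -
    from that obtain a b a' b' where "\<forall>n. (a n, b n) \<in> G" "a \<longlonglongrightarrow> u" "b \<longlonglongrightarrow> w"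
      "\<forall>n. (a' n, b' n) \<in> G" "a' \<longlonglongrightarrow> u'" "b' \<longlonglongrightarrow> w'" unfolding L_def by auto
    then show ?thesis unfolding L_def
      by (intro exI[of _ "\<lambda>n. a n + a' n"] exI[of _ "\<lambda>n. b n + b' n"]) (simp add: add tendsto_add)
  qed
  have L_scale: "L (c *\<^sub>C u) (c *\<^sub>C w)" if "L u w" for c u w
  proof -
    from that obtain a b where "\<forall>n. (a n, b n) \<in> G" "a \<longlonglongrightarrow> u" "b \<longlonglongrightarrow> w" unfolding L_def by auto
    then show ?thesis unfolding L_def
      by (intro exI[of _ "\<lambda>n. c *\<^sub>C a n"] exI[of _ "\<lambda>n. c *\<^sub>C b n"])
        (simp add: scale bounded_linear.tendsto[OF bounded_linear_scaleC])
  qed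
  have L_bound: "norm w \<le> C * norm u" if "L u w" for u w
  proof -
    from that obtain a b where ab: "\<forall>n. (a n, b n) \<in> G" "a \<longlonglongrightarrow> u" "b \<longlonglongrightarrow> w" unfolding L_def by auto
    show ?thesis
      by (rule LIMSEQ_le[OF tendsto_norm[OF ab(3)] tendsto_mult[OF tendsto_const tendsto_norm[OF ab(2)]]])
        (use ab(1) bound in blast)
  qed
  have L_ex: "\<exists>w. L u w" for u
  proof -
    have "u \<in> closure (fst ` G)" using dense by simp
    then obtain a where a: "\<And>n. a n \<in> fst ` G" "a \<longlonglongrightarrow> u" unfolding closure_sequential by auto
    then have "\<forall>n. \<exists>b. (a n, b) \<in> G" by force
    then obtain b where b: "\<And>n. (a n, b n) \<in> G" by metis
    have bnd: "dist (b m) (b n) \<le> \<bar>C\<bar> * dist (a m) (a n)" for m n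
    proof -
      have "dist (b m) (b n) \<le> C * dist (a m) (a n)"
        using bound[OF diff[OF b b]] by (simp add: dist_norm)
      also have "\<dots> \<le> \<bar>C\<bar> * dist (a m) (a n)" by (simp add: mult_right_mono)
      finally show ?thesis .
    qed
    have "Cauchy b"
    proof (rule metric_CauchyI)
      fix e :: real assume "e > 0"
      then have "e / (\<bar>C\<bar> + 1) > 0" by (simp add: add_nonneg_pos)
      then obtain N where N: "\<And>m n. m \<ge> N \<Longrightarrow> n \<ge> N \<Longrightarrow> dist (a m) (a n) < e / (\<bar>C\<bar> + 1)"
        using metric_CauchyD[OF LIMSEQ_imp_Cauchy[OF a(2)]] by blast
      have "dist (b m) (b n) < e" if "m \<ge> N" "n \<ge> N" for m n
      proof -
        have "dist (b m) (b n) \<le> (\<bar>C\<bar> + 1) * dist (a m) (a n)"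
          using bnd[of m n] by (simp add: distrib_right add_increasing2)
        also have "\<dots> < e" using N[OF that] by (simp add: pos_less_divide_eq mult.commute add_nonneg_pos)
        finally show ?thesis .
      qed
      then show "\<exists>N. \<forall>m\<ge>N. \<forall>n\<ge>N. dist (b m) (b n) < e" by blast
    qed
    then obtain w where "b \<longlonglongrightarrow> w" using Cauchy_convergent_iff convergent_def by blast
    with a(2) b show ?thesis unfolding L_def by blast
  qed
  have L_unique: "w = w'" if "L u w" "L u w'" for u w w'
  proof -
    have "L (u + (-1) *\<^sub>C u) (w + (-1) *\<^sub>C w')" by (intro L_add L_scale that)
    from L_bound[OF this] show ?thesis by (simp add: complex_vector.scale_minus_left scaleC_one)
  qed
  obtain f where f: "\<And>u. L u (f u)" using L_ex by metis
  have "bop_apply (Bop f) = f"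
  proof (rule bop_apply_Bop)
    show "f (x + y) = f x + f y" for x y by (rule L_unique[OF f L_add[OF f f]])
    show "f (c *\<^sub>C x) = c *\<^sub>C f x" for c x by (rule L_unique[OF f L_scale[OF f]])
    show "norm (f x) \<le> norm x * C" for x using L_bound[OF f] by (simp add: mult.commute)
  qed
  moreover have "f u = v" if "(u, v) \<in> G" for u v
  proof (rule L_unique[OF f])
    show "L u v" unfolding L_def
      by (rule exI[of _ "\<lambda>_. u"], rule exI[of _ "\<lambda>_. v"]) (simp add: that)
  qed
  ultimately show ?thesis by (intro exI[of _ "Bop f"]) simp
qed

context
  fixes t :: "'h::complex_hilbert \<Rightarrow> 'k::complex_hilbert \<Rightarrow> 'p::complex_hilbert"
  assumes t: "hilbert_tensor t"
begin

lemma tensor_add_left: "t (h + h') k = t h k + t h' k"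
  and tensor_scaleC_left: "t (c *\<^sub>C h) k = c *\<^sub>C t h k"
  and tensor_add_right: "t h (k + k') = t h k + t h k'"
  and tensor_scaleC_right: "t h (c *\<^sub>C k) = c *\<^sub>C t h k"
  and cinner_tensor: "cinner (t h k) (t h' k') = cinner h h' * cinner k k'"
  and dense_tensors: "closure (cspan {t h k | h k. True}) = UNIV"
  using t unfolding hilbert_tensor_def clinear_on_def by blast+

lemma tensor_zero_left: "t 0 k = 0"
  using tensor_scaleC_left[of 0 0 k] by (simp add: complex_vector.scale_zero_left)

lemma tensor_sum_right: "t h (sum f I) = (\<Sum>i\<in>I. t h (f i))"
proof -
  have "t h 0 = 0" using tensor_scaleC_right[of h 0 0] by (simp add: complex_vector.scale_zero_left)
  then show ?thesis by (induction I rule: infinite_finite_induct) (simp_all add: tensor_add_right)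
qed

lemma norm_tensor: "norm (t h k) = norm h * norm k"
proof -
  have "complex_of_real ((norm (t h k))\<^sup>2) = complex_of_real ((norm h * norm k)\<^sup>2)"
    using cinner_tensor[of h k h k] unfolding cinner_self by (simp add: power_mult_distrib)
  then have "(norm (t h k))\<^sup>2 = (norm h * norm k)\<^sup>2" using of_real_eq_iff by blast
  then show ?thesis by simp
qed

lemma hilbert_tensor_flip: "hilbert_tensor (\<lambda>k h. t h k)"
proof -
  have "{t h k | k h. True} = {t h k | h k. True}" by blast
  then show ?thesis
    using t unfolding hilbert_tensor_def by (simp add: mult.commute)
qed

lemma bop_eq_on_tensors:
  assumes eq: "\<And>h k. bop_apply V (t h k) = bop_apply W (t h k)"
  shows "V = W"
proof (rule bop_eqI)
  fix u
  let ?Z = "{u. bop_apply V u = bop_apply W u}"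
  have "cspan {t h k | h k. True} \<subseteq> ?Z"
    by (rule complex_vector.span_minimal)
      (use eq in \<open>auto simp: complex_vector.subspace_def bop_add bop_scaleC bop_zero\<close>)
  moreover have "closed ?Z"
    by (intro closed_Collect_eq linear_continuous_on bounded_linear_bop)
  ultimately have "closure (cspan {t h k | h k. True}) \<subseteq> ?Z" by (rule closure_minimal)
  then show "bop_apply V u = bop_apply W u" using dense_tensors by auto
qed

text \<open>Expanding the second tensor factors in \<open>E\<close>. The expansion coefficients do not involve the first
  factors, so that the same \<open>E\<close> serves for a sum of tensors \<open>h \<otimes> k\<close> and for its image, the sum of the
  tensors \<open>S h \<otimes> k\<close>.\<close>

lemma tensor_list_orthonormal:
  assumes "\<And>h k. (h, k) \<in> set xs \<Longrightarrow> k = (\<Sum>e\<in>E. cinner k e *\<^sub>C e)"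
  shows "(\<Sum>(h, k)\<leftarrow>xs. t h k) = (\<Sum>e\<in>E. t (\<Sum>(h, k)\<leftarrow>xs. cinner k e *\<^sub>C h) e)"
  using assms
proof (induction xs)
  case Nil
  then show ?case by (simp add: tensor_zero_left)
next
  case (Cons x xs)
  obtain h k where x: "x = (h, k)" by (cases x)
  have "t h k = t h (\<Sum>e\<in>E. cinner k e *\<^sub>C e)" using Cons.prems[of h k] x by simp
  also have "\<dots> = (\<Sum>e\<in>E. t (cinner k e *\<^sub>C h) e)"
    by (simp add: tensor_sum_right tensor_scaleC_left tensor_scaleC_right)
  finally have "t h k = (\<Sum>e\<in>E. t (cinner k e *\<^sub>C h) e)" .
  moreover have "(\<Sum>(h, k)\<leftarrow>xs. t h k) = (\<Sum>e\<in>E. t (\<Sum>(h, k)\<leftarrow>xs. cinner k e *\<^sub>C h) e)"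
  proof (rule Cons.IH)
    show "k = (\<Sum>e\<in>E. cinner k e *\<^sub>C e)" if "(h, k) \<in> set xs" for h k
      by (rule Cons.prems[of h]) (simp add: that)
  qed
  ultimately show ?case by (simp add: x tensor_add_left sum.distrib)
qed

lemma norm_orthonormal_tensor:
  assumes "finite E" "orthonormal E"
  shows "(norm (\<Sum>e\<in>E. t (g e) e))\<^sup>2 = (\<Sum>e\<in>E. (norm (g e))\<^sup>2)"
proof -
  have "cinner (\<Sum>e\<in>E. t (g e) e) (\<Sum>e\<in>E. t (g e) e)
      = (\<Sum>e\<in>E. \<Sum>e'\<in>E. cinner (t (g e') e') (t (g e) e))"
    unfolding cinner.sum_left cinner.sum_right ..
  also have "\<dots> = (\<Sum>e\<in>E. \<Sum>e'\<in>E. if e' = e then complex_of_real ((norm (g e))\<^sup>2) else 0)"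
    using assms(2) by (intro sum.cong) (auto simp: cinner_tensor orthonormal_def cinner_self)
  also have "\<dots> = complex_of_real (\<Sum>e\<in>E. (norm (g e))\<^sup>2)" using assms(1) by simp
  finally show ?thesis unfolding cinner_self of_real_eq_iff .
qed

lemma cspan_tensors_list:
  assumes "u \<in> cspan {t h k | h k. True}"
  obtains xs where "u = (\<Sum>(h, k)\<leftarrow>xs. t h k)"
proof -
  let ?R = "range (\<lambda>xs. \<Sum>(h, k)\<leftarrow>xs. t h k)"
  have "csubspace ?R" unfolding complex_vector.subspace_def
  proof (intro conjI ballI allI)
    show "0 \<in> ?R" by (rule range_eqI[of _ _ "[]"]) simp
    fix u v assume "u \<in> ?R" "v \<in> ?R"
    then obtain xs ys where "u = (\<Sum>(h, k)\<leftarrow>xs. t h k)" "v = (\<Sum>(h, k)\<leftarrow>ys. t h k)" by blast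
    then show "u + v \<in> ?R" by (intro range_eqI[of _ _ "xs @ ys"]) simp
  next
    fix c u assume "u \<in> ?R"
    then obtain xs where xs: "u = (\<Sum>(h, k)\<leftarrow>xs. t h k)" by blast
    have "c *\<^sub>C (\<Sum>(h, k)\<leftarrow>xs. t h k) = (\<Sum>(h, k)\<leftarrow>map (apfst ((*\<^sub>C) c)) xs. t h k)"
      by (induction xs) (auto simp: scaleC_add_right tensor_scaleC_left complex_vector.scale_zero_right)
    then show "c *\<^sub>C u \<in> ?R" unfolding xs by (rule range_eqI)
  qed
  moreover have "{t h k | h k. True} \<subseteq> ?R"
  proof clarify
    fix h k show "t h k \<in> ?R" by (rule range_eqI[of _ _ "[(h, k)]"]) simp
  qed
  ultimately have "cspan {t h k | h k. True} \<subseteq> ?R" by (rule complex_vector.span_minimal[rotated])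
  with assms that show ?thesis by blast
qed

text \<open>\<open>L\<close> is the adjoint of \<open>h \<mapsto> h \<otimes> k\<close>.\<close>

lemma tensor_left_adjoint:
  obtains L where "\<And>h u. cinner (t h k) u = cinner h (bop_apply L u)"
    "\<And>u. norm (bop_apply L u) \<le> norm k * norm u"
proof -
  have V: "bop_apply (Bop (\<lambda>h. t h k)) = (\<lambda>h. t h k)"
    by (rule bop_apply_Bop[where K = "norm k"]) (simp_all add: tensor_add_left tensor_scaleC_left norm_tensor)
  obtain L where L: "\<And>h u. cinner (t h k) u = cinner h (bop_apply L u)"
    using bop_adjoint[of "Bop (\<lambda>h. t h k)"] unfolding V by blast
  have "norm (bop_apply L u) \<le> norm k * norm u" for u
  proof -
    have "(norm (bop_apply L u))\<^sup>2 = cmod (cinner (t (bop_apply L u) k) u)"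
      unfolding L cinner_self by (simp add: norm_power)
    also have "\<dots> \<le> norm (bop_apply L u) * norm k * norm u"
      using norm_cinner_le[of "t (bop_apply L u) k" u] by (simp add: norm_tensor)
    finally have "norm (bop_apply L u) * norm (bop_apply L u) \<le> norm (bop_apply L u) * (norm k * norm u)"
      by (simp add: power2_eq_square mult.assoc)
    then show ?thesis by (cases "norm (bop_apply L u) = 0") (auto simp: mult_le_cancel_left_pos)
  qed
  with L show ?thesis by (rule that)
qed

end

text \<open>\<open>S \<otimes> 1\<close>, allowing \<open>S\<close> to act between different Hilbert spaces as bimodule elements do.\<close>

definition ampliation where
  "ampliation t t' S = (THE W. \<forall>h k. bop_apply W (t h k) = t' (bop_apply S h) k)"

text \<open>On a finite sum of tensors whose second factors are orthonormal, \<open>S \<otimes> 1\<close> is bounded by any bound of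
  \<open>S\<close>, by Pythagoras; Gram-Schmidt brings every finite sum of tensors into this form.\<close>

lemma ampliation_apply:
  fixes t :: "'h::complex_hilbert \<Rightarrow> 'k::complex_hilbert \<Rightarrow> 'p::complex_hilbert"
    and t' :: "'h'::complex_hilbert \<Rightarrow> 'k \<Rightarrow> 'p'::complex_hilbert"
  assumes t: "hilbert_tensor t" and t': "hilbert_tensor t'"
  shows "bop_apply (ampliation t t' S) (t h k) = t' (bop_apply S h) k"
proof -
  define G where "G = {((\<Sum>(h, k)\<leftarrow>xs. t h k), (\<Sum>(h, k)\<leftarrow>xs. t' (bop_apply S h) k)) | xs. True}"
  obtain K where K: "K > 0" "\<And>x. norm (bop_apply S x) \<le> K * norm x" using bop_norm_bound[of S] by blast
  have "\<exists>W. \<forall>u v. (u, v) \<in> G \<longrightarrow> bop_apply W u = v"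
  proof (rule bounded_extension[where C = K])
    fix u v u' v' assume "(u, v) \<in> G" "(u', v') \<in> G"
    then obtain xs ys where "u = (\<Sum>(h, k)\<leftarrow>xs. t h k)" "v = (\<Sum>(h, k)\<leftarrow>xs. t' (bop_apply S h) k)"
      "u' = (\<Sum>(h, k)\<leftarrow>ys. t h k)" "v' = (\<Sum>(h, k)\<leftarrow>ys. t' (bop_apply S h) k)"
      unfolding G_def by blast
    then show "(u + u', v + v') \<in> G" unfolding G_def by (auto intro!: exI[of _ "xs @ ys"])
  next
    fix c u v assume "(u, v) \<in> G"
    then obtain xs where xs: "u = (\<Sum>(h, k)\<leftarrow>xs. t h k)" "v = (\<Sum>(h, k)\<leftarrow>xs. t' (bop_apply S h) k)"
      unfolding G_def by blast
    have "c *\<^sub>C (\<Sum>(h, k)\<leftarrow>xs. t h k) = (\<Sum>(h, k)\<leftarrow>map (apfst ((*\<^sub>C) c)) xs. t h k)"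
      "c *\<^sub>C (\<Sum>(h, k)\<leftarrow>xs. t' (bop_apply S h) k)
        = (\<Sum>(h, k)\<leftarrow>map (apfst ((*\<^sub>C) c)) xs. t' (bop_apply S h) k)"
      by (induction xs) (auto simp: scaleC_add_right tensor_scaleC_left[OF t] tensor_scaleC_left[OF t']
          bop_scaleC complex_vector.scale_zero_right)
    then show "(c *\<^sub>C u, c *\<^sub>C v) \<in> G" unfolding G_def xs by blast
  next
    fix u v assume "(u, v) \<in> G"
    then obtain xs where xs: "u = (\<Sum>(h, k)\<leftarrow>xs. t h k)" "v = (\<Sum>(h, k)\<leftarrow>xs. t' (bop_apply S h) k)"
      unfolding G_def by blast
    obtain E where E: "finite E" "orthonormal E" "\<forall>k\<in>snd ` set xs. k = (\<Sum>e\<in>E. cinner k e *\<^sub>C e)"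
      using gram_schmidt[of "snd ` set xs"] by auto
    define g where "g e = (\<Sum>(h, k)\<leftarrow>xs. cinner k e *\<^sub>C h)" for e
    define ys where "ys = map (apfst (bop_apply S)) xs"
    have u: "u = (\<Sum>e\<in>E. t (g e) e)"
      unfolding xs g_def by (rule tensor_list_orthonormal[OF t]) (use E(3) in force)
    have Sg: "(\<Sum>(h, k)\<leftarrow>ys. cinner k e *\<^sub>C h) = bop_apply S (g e)" for e
      unfolding g_def ys_def by (induction xs) (auto simp: bop_add bop_scaleC bop_zero)
    have "v = (\<Sum>(h, k)\<leftarrow>ys. t' h k)"
      unfolding xs ys_def by (induction xs) auto
    also have "\<dots> = (\<Sum>e\<in>E. t' (bop_apply S (g e)) e)"
      unfolding Sg[symmetric] by (rule tensor_list_orthonormal[OF t']) (use E(3) in \<open>force simp: ys_def\<close>)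
    finally have "(norm v)\<^sup>2 = (\<Sum>e\<in>E. (norm (bop_apply S (g e)))\<^sup>2)"
      using norm_orthonormal_tensor[OF t' E(1,2)] by simp
    also have "\<dots> \<le> (\<Sum>e\<in>E. (K * norm (g e))\<^sup>2)" by (intro sum_mono power_mono K) simp
    also have "\<dots> = K\<^sup>2 * (norm u)\<^sup>2"
      unfolding u norm_orthonormal_tensor[OF t E(1,2)] by (simp add: power_mult_distrib sum_distrib_left)
    also have "\<dots> = (K * norm u)\<^sup>2" by (simp add: power_mult_distrib)
    finally show "norm v \<le> K * norm u" by (rule power2_le_imp_le) (use K(1) in simp)
  next
    have "cspan {t h k | h k. True} \<subseteq> fst ` G"
    proof
      fix u assume "u \<in> cspan {t h k | h k. True}"
      then obtain xs where "u = (\<Sum>(h, k)\<leftarrow>xs. t h k)" by (rule cspan_tensors_list[OF t])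
      then show "u \<in> fst ` G" unfolding G_def by force
    qed
    from closure_mono[OF this] show "closure (fst ` G) = UNIV" unfolding dense_tensors[OF t] by blast
  qed
  then obtain W where W: "\<And>u v. (u, v) \<in> G \<Longrightarrow> bop_apply W u = v" by blast
  have W': "\<forall>h k. bop_apply W (t h k) = t' (bop_apply S h) k"
  proof (intro allI W)
    fix h k show "(t h k, t' (bop_apply S h) k) \<in> G" unfolding G_def by (auto intro!: exI[of _ "[(h, k)]"])
  qed
  have "\<forall>h k. bop_apply (ampliation t t' S) (t h k) = t' (bop_apply S h) k"
    unfolding ampliation_def
    by (rule theI', rule ex1I[of _ W], rule W', rule bop_eq_on_tensors[OF t]) (simp add: W')
  then show ?thesis by blast
qed

text \<open>Existence of the operator: \<open>S \<otimes> T = (S \<otimes> 1)(1 \<otimes> T)\<close>, where the second factor is an ampliation for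
  the tensor product with its factors exchanged.\<close>

lemma tensor_op_apply:
  assumes t: "hilbert_tensor t"
  shows "bop_apply (tensor_op t S T) (t h k) = t (bop_apply S h) (bop_apply T k)"
proof -
  define W where "W = ampliation t t S \<cdot> ampliation (\<lambda>k h. t h k) (\<lambda>k h. t h k) T"
  note flip = hilbert_tensor_flip[OF t]
  have W: "\<forall>h k. bop_apply W (t h k) = t (bop_apply S h) (bop_apply T k)"
    using ampliation_apply[OF flip flip, of T]
    by (simp add: W_def bop_comp.rep_eq ampliation_apply[OF t t])
  have "\<forall>h k. bop_apply (tensor_op t S T) (t h k) = t (bop_apply S h) (bop_apply T k)"
    unfolding tensor_op_def
    by (rule theI', rule ex1I[of _ W], rule W, rule bop_eq_on_tensors[OF t]) (simp add: W)
  then show ?thesis by blast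
qed

section \<open>Normality of ampliations\<close>

text \<open>\<open>\<Sum>\<^sub>e a\<^sub>e \<otimes> e\<close> is the orthogonal projection of \<open>v\<close> onto the tensors whose second factors lie in
  the span of \<open>E\<close>.\<close>

lemma bessel_tensor:
  assumes t: "hilbert_tensor t" and E: "finite E" "orthonormal E"
    and a: "\<And>h e. e \<in> E \<Longrightarrow> cinner (t h e) v = cinner h (a e)"
  shows "(\<Sum>e\<in>E. (norm (a e))\<^sup>2) \<le> (norm v)\<^sup>2"
proof -
  define P where "P = (\<Sum>e\<in>E. t (a e) e)"
  have P: "(norm P)\<^sup>2 = (\<Sum>e\<in>E. (norm (a e))\<^sup>2)"
    unfolding P_def by (rule norm_orthonormal_tensor[OF t E])
  have "cinner P v = (\<Sum>e\<in>E. complex_of_real ((norm (a e))\<^sup>2))"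
    unfolding P_def cinner.sum_left by (intro sum.cong refl) (simp add: a cinner_self)
  also have "\<dots> = complex_of_real ((norm P)\<^sup>2)" unfolding P by simp
  finally have "(norm P)\<^sup>2 \<le> norm P * norm v"
    using norm_cinner_le[of P v] by (simp add: norm_power)
  then have "norm P \<le> norm v" by (cases "P = 0") (auto simp: power2_eq_square)
  then show ?thesis unfolding P[symmetric] by (simp add: power_mono)
qed

text \<open>With \<open>u = \<Sum>\<^sub>e g\<^sub>e \<otimes> e\<close> for an orthonormal \<open>E\<close>, the functional is \<open>S \<mapsto> \<Sum>\<^sub>e \<langle>S g\<^sub>e, a\<^sub>e\<rangle>\<close>. Its
  bound is controlled by the Cauchy-Schwarz and Bessel inequalities, and does not depend on the number
  of terms.\<close>

lemma ampliation_coefficient_finite: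
  fixes t :: "'h::complex_hilbert \<Rightarrow> 'k::complex_hilbert \<Rightarrow> 'p::complex_hilbert"
    and t' :: "'h'::complex_hilbert \<Rightarrow> 'k \<Rightarrow> 'p'::complex_hilbert"
  assumes t: "hilbert_tensor t" and t': "hilbert_tensor t'"
    and u: "u \<in> cspan {t h k | h k. True}"
  shows "nuclear_bound (\<lambda>S. cinner (bop_apply (ampliation t t' S) u) v) (norm u * norm v)"
proof -
  obtain xs where xs: "u = (\<Sum>(h, k)\<leftarrow>xs. t h k)" using u by (rule cspan_tensors_list[OF t])
  obtain E where E: "finite E" "orthonormal E" "\<forall>k\<in>snd ` set xs. k = (\<Sum>e\<in>E. cinner k e *\<^sub>C e)"
    using gram_schmidt[of "snd ` set xs"] by auto
  define g where "g e = (\<Sum>(h, k)\<leftarrow>xs. cinner k e *\<^sub>C h)" for e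
  have u: "u = (\<Sum>e\<in>E. t (g e) e)"
    unfolding xs g_def by (rule tensor_list_orthonormal[OF t]) (use E(3) in force)
  have "\<exists>a. \<forall>h. cinner (t' h e) v = cinner h a" for e
    using tensor_left_adjoint[OF t', of e] by metis
  then obtain a where a: "\<And>h e. cinner (t' h e) v = cinner h (a e)" by metis
  have "cinner (bop_apply (ampliation t t' S) u) v = (\<Sum>e\<in>E. cinner (bop_apply S (g e)) (a e))" for S
    unfolding u bop_sum cinner.sum_left by (simp add: ampliation_apply[OF t t'] a)
  moreover have "nuclear_bound (\<lambda>S. \<Sum>e\<in>E. cinner (bop_apply S (g e)) (a e))
      (\<Sum>e\<in>E. norm (g e) * norm (a e))"
    by (rule nuclear_bound_sum[OF E(1) nuclear_bound_rank_one])
  moreover have "(\<Sum>e\<in>E. norm (g e) * norm (a e)) \<le> norm u * norm v"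
  proof (rule power2_le_imp_le)
    have "(\<Sum>e\<in>E. norm (g e) * norm (a e))\<^sup>2 \<le> (\<Sum>e\<in>E. (norm (g e))\<^sup>2) * (\<Sum>e\<in>E. (norm (a e))\<^sup>2)"
      by (rule Cauchy_Schwarz_ineq_sum)
    also have "\<dots> \<le> (norm u)\<^sup>2 * (norm v)\<^sup>2"
      unfolding u norm_orthonormal_tensor[OF t E(1,2)]
      by (intro mult_left_mono bessel_tensor[OF t' E(1,2) a] sum_nonneg) simp
    finally show "(\<Sum>e\<in>E. norm (g e) * norm (a e))\<^sup>2 \<le> (norm u * norm v)\<^sup>2"
      by (simp add: power_mult_distrib)
  qed simp
  ultimately show ?thesis by (simp add: nuclear_bound_mono)
qed

text \<open>A general \<open>u\<close> is a series of finite sums of tensors whose norms decrease geometrically, so that the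
  functionals of the terms add up to a normal one. The factor \<open>4\<close> is the price of the telescoping.\<close>

lemma ampliation_coefficient:
  fixes t :: "'h::complex_hilbert \<Rightarrow> 'k::complex_hilbert \<Rightarrow> 'p::complex_hilbert"
    and t' :: "'h'::complex_hilbert \<Rightarrow> 'k \<Rightarrow> 'p'::complex_hilbert"
  assumes t: "hilbert_tensor t" and t': "hilbert_tensor t'"
  shows "nuclear_bound (\<lambda>S. cinner (bop_apply (ampliation t t' S) u) v) (4 * norm u * norm v)"
proof -
  let ?D = "cspan {t h k | h k. True}"
  have "\<exists>s\<in>?D. norm (s - u) \<le> norm u * (1/2) ^ m" for m
  proof (cases "u = 0")
    case True
    then show ?thesis using complex_vector.span_zero by force
  next
    case False
    then have "norm u * (1/2) ^ m > 0" by simp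
    moreover have "u \<in> closure ?D" using dense_tensors[OF t] by simp
    ultimately show ?thesis unfolding closure_approachable dist_norm by (meson less_imp_le)
  qed
  then obtain s' where s': "\<And>m. s' m \<in> ?D" "\<And>m. norm (s' m - u) \<le> norm u * (1/2) ^ m" by metis
  define s where "s m = (if m = 0 then 0 else s' m)" for m
  have s: "s m \<in> ?D" "norm (s m - u) \<le> norm u * (1/2) ^ m" for m
    using s' complex_vector.span_zero by (auto simp: s_def)
  have lim: "s \<longlonglongrightarrow> u"
  proof (rule LIM_zero_cancel, rule Lim_null_comparison)
    show "\<forall>\<^sub>F m in sequentially. norm (s m - u) \<le> norm u * (1/2) ^ m" using s(2) by simp
    show "(\<lambda>m. norm u * (1/2) ^ m) \<longlonglongrightarrow> 0"
      by (rule tendsto_mult_right_zero) (rule LIMSEQ_power_zero, simp)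
  qed
  define w where "w m = s (Suc m) - s m" for m
  have w: "w m \<in> ?D" for m unfolding w_def by (intro complex_vector.span_diff s)
  have norm_w: "norm (w m) \<le> 2 * norm u * (1/2) ^ m" for m
  proof -
    have "norm (w m) \<le> norm (s (Suc m) - u) + norm (s m - u)"
      unfolding w_def using norm_triangle_ineq4[of "s (Suc m) - u" "s m - u"] by simp
    also have "\<dots> \<le> norm u * (1/2) ^ Suc m + norm u * (1/2) ^ m" by (intro add_mono s)
    also have "\<dots> \<le> norm u * (1/2) ^ m + norm u * (1/2) ^ m"
      by (intro add_mono mult_left_mono) simp_all
    finally show ?thesis by simp
  qed
  have w_sums: "w sums u" using telescope_sums[OF lim] by (simp add: w_def[abs_def] s_def[of 0])
  have geo: "(\<lambda>m. 2 * norm u * (1/2) ^ m * norm v) sums (4 * norm u * norm v)"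
    using sums_mult[OF geometric_sums[of "1/2::real"], of "2 * norm u * norm v"]
    by (simp add: mult_ac)
  have bnd: "nuclear_bound (\<lambda>S. cinner (bop_apply (ampliation t t' S) (w m)) v)
      (2 * norm u * (1/2) ^ m * norm v)" for m
    by (rule nuclear_bound_mono[OF ampliation_coefficient_finite[OF t t' w]])
      (rule mult_right_mono[OF norm_w norm_ge_zero])
  have eq: "cinner (bop_apply W u) v = (\<Sum>m. cinner (bop_apply W (w m)) v)" for W :: "('p, 'p') bop"
    using bounded_linear.sums[OF bounded_linear_compose[OF cinner.bounded_linear_left bounded_linear_bop] w_sums]
    by (rule sums_unique)
  show ?thesis
    unfolding eq using nuclear_bound_suminf[OF bnd sums_summable[OF geo]]
    unfolding sums_unique[OF geo, symmetric] .
qed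

text \<open>The coefficients of \<open>S \<otimes> 1\<close> at the pairs \<open>(x\<^sub>n, y\<^sub>n)\<close> that represent \<open>\<phi>\<close> have summable bounds,
  so that the coefficient bound for a single pair settles the general case.\<close>

theorem normal_ampliation:
  fixes t :: "'h::complex_hilbert \<Rightarrow> 'k::complex_hilbert \<Rightarrow> 'p::complex_hilbert"
    and t' :: "'h'::complex_hilbert \<Rightarrow> 'k \<Rightarrow> 'p'::complex_hilbert"
  assumes t: "hilbert_tensor t" and t': "hilbert_tensor t'" and \<phi>: "\<phi> \<in> normal_functionals"
  shows "(\<lambda>S. \<phi> (ampliation t t' S)) \<in> normal_functionals"
proof -
  from \<phi> obtain x y where xy: "square_summable x" "square_summable y"
    "\<And>T. \<phi> T = (\<Sum>n. cinner (bop_apply T (x n)) (y n))" by (rule normal_functionalsE) blast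
  have "summable (\<lambda>n. 4 * ((norm (x n))\<^sup>2 + (norm (y n))\<^sup>2))"
    using xy(1,2) unfolding square_summable_def by (intro summable_mult summable_add)
  then have "summable (\<lambda>n. 4 * norm (x n) * norm (y n))"
  proof (rule summable_comparison_test'[where N = 0])
    fix n
    show "norm (4 * norm (x n) * norm (y n)) \<le> 4 * ((norm (x n))\<^sup>2 + (norm (y n))\<^sup>2)"
      using mult_left_mono[OF mult_le_sum_squares[of "norm (x n)" "norm (y n)"], of 4]
      by (simp add: abs_mult mult.assoc del: distrib_left_numeral)
  qed
  from normal_suminf[OF ampliation_coefficient[OF t t'] this] show ?thesis unfolding xy(3) .
qed

section \<open>Slice maps\<close>

text \<open>Weak* continuity, as it is tested on the predual. Linearity of \<open>R\<close> follows, because normal functionals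
  are linear and separate points.\<close>

definition normal_map ::
  "(('a::complex_hilbert, 'b::complex_hilbert) bop \<Rightarrow> ('c::complex_hilbert, 'd::complex_hilbert) bop) \<Rightarrow> bool"
  where "normal_map R \<longleftrightarrow> (\<forall>\<phi>\<in>normal_functionals. (\<lambda>T. \<phi> (R T)) \<in> normal_functionals)"

lemma normal_separate:
  assumes "\<And>\<phi>. \<phi> \<in> normal_functionals \<Longrightarrow> \<phi> S = \<phi> T"
  shows "S = T"
proof (rule bop_eqI, rule cinner_eqI)
  fix x y show "cinner (bop_apply S x) y = cinner (bop_apply T x) y"
    using assms[OF normal_rank_one[of x y]] .
qed

text \<open>The operator \<open>\<Sum>\<^sub>n L\<^sub>n T V\<^sub>n\<close>, where \<open>V\<^sub>n k = x\<^sub>n \<otimes> k\<close> and \<open>L\<^sub>n\<close> is the adjoint of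
  \<open>l \<mapsto> y\<^sub>n \<otimes> l\<close>; the series converges absolutely.\<close>

lemma slice_operator:
  assumes t: "hilbert_tensor t" and x: "square_summable x" and y: "square_summable y"
  shows "\<exists>R. \<forall>k l. cinner (bop_apply R k) l = (\<Sum>n. cinner (bop_apply T (t (x n) k)) (t (y n) l))"
proof -
  have "\<exists>L. (\<forall>l u. cinner (t y l) u = cinner l (bop_apply L u)) \<and> (\<forall>u. norm (bop_apply L u) \<le> norm y * norm u)"
    for y using tensor_left_adjoint[OF hilbert_tensor_flip[OF t], of y] by metis
  then obtain L where L: "\<And>y l u. cinner (t y l) u = cinner l (bop_apply (L y) u)"
    "\<And>y u. norm (bop_apply (L y) u) \<le> norm y * norm u" by metis
  obtain K where K: "K > 0" "\<And>u. norm (bop_apply T u) \<le> K * norm u" using bop_norm_bound[of T] by blast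
  define z where "z k n = bop_apply (L (y n)) (bop_apply T (t (x n) k))" for k n
  define c where "c n = K * ((norm (x n))\<^sup>2 + (norm (y n))\<^sup>2)" for n
  have c: "summable c"
    using x y unfolding square_summable_def c_def by (intro summable_mult summable_add)
  have zc: "norm (z k n) \<le> c n * norm k" for k n
  proof -
    have "norm (z k n) \<le> norm (y n) * (K * (norm (x n) * norm k))"
      unfolding z_def using K(2)[of "t (x n) k"]
      by (intro order_trans[OF L(2)] mult_left_mono) (simp_all add: norm_tensor[OF t])
    also have "\<dots> = K * norm k * (norm (x n) * norm (y n))" by simp
    also have "\<dots> \<le> K * norm k * ((norm (x n))\<^sup>2 + (norm (y n))\<^sup>2)"
      by (rule mult_left_mono[OF mult_le_sum_squares]) (use K(1) in simp)
    finally show ?thesis by (simp add: c_def mult_ac)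
  qed
  have zn: "summable (\<lambda>n. norm (z k n))" for k
    by (rule summable_comparison_test'[OF summable_mult2[OF c, of "norm k"], where N = 0]) (simp add: zc)
  note zs = summable_norm_cancel[OF zn]
  define f where "f k = (\<Sum>n. z k n)" for k
  have "bop_apply (Bop f) = f"
  proof (rule bop_apply_Bop)
    show "f (k + l) = f k + f l" for k l
      unfolding f_def suminf_add[OF zs zs] by (simp add: z_def[abs_def] tensor_add_right[OF t] bop_add)
    show "f (a *\<^sub>C k) = a *\<^sub>C f k" for a k
      unfolding f_def bounded_linear.suminf[OF bounded_linear_scaleC zs]
      by (simp add: z_def[abs_def] tensor_scaleC_right[OF t] bop_scaleC)
    show "norm (f k) \<le> norm k * (\<Sum>n. c n)" for k
    proof -
      have "norm (f k) \<le> (\<Sum>n. norm (z k n))" unfolding f_def by (rule summable_norm[OF zn])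
      also have "\<dots> \<le> (\<Sum>n. c n * norm k)" by (rule suminf_le[OF zc zn summable_mult2[OF c]])
      finally show ?thesis by (simp add: suminf_mult[OF c] mult.commute)
    qed
  qed
  moreover have "cinner (f k) l = (\<Sum>n. cinner (bop_apply T (t (x n) k)) (t (y n) l))" for k l
  proof -
    have L': "cinner (bop_apply (L y) u) l = cinner u (t y l)" for y u
      by (metis L(1) cinner_commute)
    show ?thesis
      unfolding f_def bounded_linear.suminf[OF cinner.bounded_linear_left zs] by (simp add: z_def[abs_def] L')
  qed
  ultimately show ?thesis by (intro exI[of _ "Bop f"]) simp
qed

text \<open>If \<open>\<psi> T = \<Sum>\<^sub>m \<langle>T a\<^sub>m, b\<^sub>m\<rangle>\<close>, then \<open>\<psi> \<circ> R\<close> is the double series of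
  \<open>\<langle>T (x\<^sub>n \<otimes> a\<^sub>m), y\<^sub>n \<otimes> b\<^sub>m\<rangle>\<close>, whose vectors are square summable over all pairs \<open>(m, n)\<close>.\<close>

theorem slice_map_exists:
  fixes t :: "'h::complex_hilbert \<Rightarrow> 'k::complex_hilbert \<Rightarrow> 'p::complex_hilbert"
  assumes t: "hilbert_tensor t" and \<phi>: "\<phi> \<in> normal_functionals"
  obtains R where "normal_map R" "\<And>S B. R (tensor_op t S B) = \<phi> S *\<^sub>C B"
proof -
  from \<phi> obtain x y where xy: "square_summable x" "square_summable y"
    "\<And>T. \<phi> T = (\<Sum>n. cinner (bop_apply T (x n)) (y n))" by (rule normal_functionalsE) blast
  obtain R where R: "\<And>T k l. cinner (bop_apply (R T) k) l = (\<Sum>n. cinner (bop_apply T (t (x n) k)) (t (y n) l))"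
    using slice_operator[OF t xy(1,2)] by metis
  have "normal_map R" unfolding normal_map_def
  proof (rule ballI)
    fix \<psi> :: "('k, 'k) bop \<Rightarrow> complex" assume "\<psi> \<in> normal_functionals"
    then obtain a b where ab: "square_summable a" "square_summable b"
      "\<And>T. \<psi> T = (\<Sum>m. cinner (bop_apply T (a m)) (b m))" by (rule normal_functionalsE) blast
    define C where "C = max (\<Sum>n. (norm (x n))\<^sup>2) (\<Sum>n. (norm (y n))\<^sup>2)"
    have C: "(\<Sum>n. (norm (x n))\<^sup>2) \<le> C" "(\<Sum>n. (norm (y n))\<^sup>2) \<le> C" by (simp_all add: C_def)
    have sq: "square_summable (\<lambda>n. t (z n) k) \<and> (\<Sum>n. (norm (t (z n) k))\<^sup>2) \<le> C * (norm k)\<^sup>2"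
      if "square_summable z" "(\<Sum>n. (norm (z n))\<^sup>2) \<le> C" for z k
      using that unfolding square_summable_def
      by (simp add: norm_tensor[OF t] power_mult_distrib summable_mult2 suminf_mult2[symmetric] mult_right_mono)
    have C0: "C \<ge> 0"
      using C(1) suminf_nonneg[of "\<lambda>n. (norm (x n))\<^sup>2"] xy(1) by (force simp: square_summable_def)
    have "nuclear_bound (\<lambda>T. \<Sum>n. cinner (bop_apply T (t (x n) (a m))) (t (y n) (b m)))
        (C * ((norm (a m))\<^sup>2 + (norm (b m))\<^sup>2))" for m
    proof -
      have "C * (norm (a m))\<^sup>2 \<le> C * ((norm (a m))\<^sup>2 + (norm (b m))\<^sup>2)"
        "C * (norm (b m))\<^sup>2 \<le> C * ((norm (a m))\<^sup>2 + (norm (b m))\<^sup>2)"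
        using C0 by (simp_all add: mult_left_mono)
      then show ?thesis
        unfolding nuclear_bound_def
        by (intro exI[of _ "\<lambda>n. t (x n) (a m)"] exI[of _ "\<lambda>n. t (y n) (b m)"])
          (use sq[OF xy(1) C(1), of "a m"] sq[OF xy(2) C(2), of "b m"] in auto)
    qed
    moreover have "summable (\<lambda>m. C * ((norm (a m))\<^sup>2 + (norm (b m))\<^sup>2))"
      using ab(1,2) unfolding square_summable_def by (intro summable_mult summable_add)
    ultimately show "(\<lambda>T. \<psi> (R T)) \<in> normal_functionals"
      unfolding ab(3) R by (rule normal_suminf)
  qed
  moreover have "R (tensor_op t S B) = \<phi> S *\<^sub>C B" for S B
  proof (rule bop_eqI, rule cinner_eqI)
    fix k l
    show "cinner (bop_apply (R (tensor_op t S B)) k) l = cinner (bop_apply (\<phi> S *\<^sub>C B) k) l"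
      by (simp add: R tensor_op_apply[OF t] cinner_tensor[OF t] xy(3) scaleC_bop.rep_eq cinner_scaleC_left
          suminf_mult2[OF summable_cinner_bop[OF xy(1,2)]])
  qed
  ultimately show ?thesis by (rule that)
qed

lemma weak_star_tensor_iff:
  "T \<in> weak_star_tensor t V U \<longleftrightarrow>
    (\<forall>\<phi>\<in>normal_functionals. (\<forall>S\<in>V. \<forall>B\<in>U. \<phi> (tensor_op t S B) = 0) \<longrightarrow> \<phi> T = 0)"
proof -
  have "(\<forall>S\<in>{tensor_op t S T | S T. S \<in> V \<and> T \<in> U}. \<phi> S = 0) \<longleftrightarrow>
      (\<forall>S\<in>V. \<forall>B\<in>U. \<phi> (tensor_op t S B) = 0)" for \<phi> :: "_ \<Rightarrow> complex" by blast
  then show ?thesis unfolding weak_star_tensor_def weak_star_closure_cspan_iff by simp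
qed

lemma normal_map_linear:
  assumes "normal_map R"
  shows "R (S + T) = R S + R T" "R (c *\<^sub>C T) = c *\<^sub>C R T"
proof -
  have R: "(\<lambda>T. \<phi> (R T)) \<in> normal_functionals" if "\<phi> \<in> normal_functionals" for \<phi>
    using assms that unfolding normal_map_def by blast
  show "R (S + T) = R S + R T"
  proof (rule normal_separate)
    fix \<phi> :: "('c, 'd) bop \<Rightarrow> complex" assume \<phi>: "\<phi> \<in> normal_functionals"
    show "\<phi> (R (S + T)) = \<phi> (R S + R T)"
      unfolding normal_linear(1)[OF \<phi>] by (rule normal_linear(1)[OF R[OF \<phi>]])
  qed
  show "R (c *\<^sub>C T) = c *\<^sub>C R T"
  proof (rule normal_separate)
    fix \<phi> :: "('c, 'd) bop \<Rightarrow> complex" assume \<phi>: "\<phi> \<in> normal_functionals"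
    show "\<phi> (R (c *\<^sub>C T)) = \<phi> (c *\<^sub>C R T)"
      unfolding normal_linear(2)[OF \<phi>] by (rule normal_linear(2)[OF R[OF \<phi>]])
  qed
qed

lemma csubspace_weak_star_closure: "csubspace (weak_star closure_of cspan G)"
  unfolding complex_vector.subspace_def
proof (intro conjI ballI allI)
  show "0 \<in> weak_star closure_of cspan G"
    unfolding weak_star_closure_cspan_iff by (intro ballI impI normal_vector_space)
  fix S T assume ST: "S \<in> weak_star closure_of cspan G" "T \<in> weak_star closure_of cspan G"
  show "S + T \<in> weak_star closure_of cspan G"
    unfolding weak_star_closure_cspan_iff
  proof (intro ballI impI)
    fix \<phi> :: "('a, 'b) bop \<Rightarrow> complex" assume \<phi>: "\<phi> \<in> normal_functionals" "\<forall>S\<in>G. \<phi> S = 0"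
    then have "\<phi> S = 0" "\<phi> T = 0" using ST unfolding weak_star_closure_cspan_iff by blast+
    then show "\<phi> (S + T) = 0" by (simp add: normal_linear[OF \<phi>(1)])
  qed
next
  fix c T assume T: "T \<in> weak_star closure_of cspan G"
  show "c *\<^sub>C T \<in> weak_star closure_of cspan G"
    unfolding weak_star_closure_cspan_iff
  proof (intro ballI impI)
    fix \<phi> :: "('a, 'b) bop \<Rightarrow> complex" assume \<phi>: "\<phi> \<in> normal_functionals" "\<forall>S\<in>G. \<phi> S = 0"
    then have "\<phi> T = 0" using T unfolding weak_star_closure_cspan_iff by blast
    then show "\<phi> (c *\<^sub>C T) = 0" by (simp add: normal_linear[OF \<phi>(1)])
  qed
qed

text \<open>Slice maps are determined by their values on elementary tensors: composed with a normal functional,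
  the difference of two of them is the restriction of a normal functional that vanishes on these
  tensors. Hence the chosen slice map can be replaced by any explicit one.\<close>

theorem right_slice_eq:
  fixes t :: "'h::complex_hilbert \<Rightarrow> 'k::complex_hilbert \<Rightarrow> 'p::complex_hilbert"
  assumes R: "normal_map R" "\<And>S B. S \<in> V \<Longrightarrow> R (tensor_op t S B) = \<omega> S *\<^sub>C B"
    and T: "T \<in> weak_star_tensor t V UNIV"
  shows "right_slice t V \<omega> T = R T"
proof -
  let ?W = "weak_star_tensor t V (UNIV :: ('k, 'k) bop set)"
  have R': "(\<lambda>T. \<phi> (R T)) \<in> normal_functionals" if "\<phi> \<in> normal_functionals" for \<phi>
    using R(1) that unfolding normal_map_def by blast
  have "is_right_slice t V \<omega> R" unfolding is_right_slice_def
  proof (intro conjI ballI allI)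
    show "clinear_on ?W R" unfolding clinear_on_def using normal_map_linear[OF R(1)] by blast
    show "continuous_map (subtopology weak_star ?W) weak_star R"
      by (intro continuous_map_from_subtopology continuous_map_into_weak_star continuous_map_normal R')
  qed (rule R(2))
  then have Q: "is_right_slice t V \<omega> (right_slice t V \<omega>)" unfolding right_slice_def by (rule someI[of "is_right_slice t V \<omega>"])
  show ?thesis
  proof (rule normal_separate)
    fix \<phi> :: "('k, 'k) bop \<Rightarrow> complex" assume \<phi>: "\<phi> \<in> normal_functionals"
    have "csubspace ?W" unfolding weak_star_tensor_def by (rule csubspace_weak_star_closure)
    moreover have "(\<lambda>T. \<phi> (right_slice t V \<omega> T)) \<in> predual ?W"
      unfolding predual_def mem_Collect_eq
    proof
      show "clinear_on ?W (\<lambda>T. \<phi> (right_slice t V \<omega> T))"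
        using Q unfolding is_right_slice_def clinear_on_def
        by (simp add: normal_linear[OF \<phi>] scaleC_complex_def)
      show "continuous_map (subtopology weak_star ?W) euclidean (\<lambda>T. \<phi> (right_slice t V \<omega> T))"
        using continuous_map_compose[OF _ continuous_map_normal[OF \<phi>]] Q
        unfolding is_right_slice_def comp_def by blast
    qed
    ultimately obtain \<psi> where \<psi>: "\<psi> \<in> normal_functionals" "\<And>T. T \<in> ?W \<Longrightarrow> \<phi> (right_slice t V \<omega> T) = \<psi> T"
      by (rule predual_eq_normal) blast
    have "(\<lambda>T. \<psi> T - \<phi> (R T)) \<in> normal_functionals" by (intro normal_diff \<psi>(1) R' \<phi>)
    moreover have "\<psi> (tensor_op t S B) - \<phi> (R (tensor_op t S B)) = 0" if "S \<in> V" for S B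
    proof -
      have "tensor_op t S B \<in> ?W" unfolding weak_star_tensor_iff using that by blast
      then have "\<psi> (tensor_op t S B) = \<phi> (right_slice t V \<omega> (tensor_op t S B))" using \<psi>(2) by simp
      also have "right_slice t V \<omega> (tensor_op t S B) = \<omega> S *\<^sub>C B"
        using Q that unfolding is_right_slice_def by blast
      finally show ?thesis by (simp add: R(2)[OF that])
    qed
    ultimately have "\<psi> T - \<phi> (R T) = 0"
      using bspec[OF T[unfolded weak_star_tensor_iff], of "\<lambda>T. \<psi> T - \<phi> (R T)"] by simp
    then show "\<phi> (right_slice t V \<omega> T) = \<phi> (R T)" by (simp add: \<psi>(2)[OF T])
  qed
qed

section \<open>Transfer along a spatial embedding\<close>

lemma ampliation_comp:
  assumes "hilbert_tensor t" "hilbert_tensor t'" "hilbert_tensor t''"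
  shows "ampliation t' t'' S' \<cdot> ampliation t t' S = ampliation t t'' (S' \<cdot> S)"
  by (rule bop_eq_on_tensors[OF assms(1)]) (simp add: bop_comp.rep_eq ampliation_apply assms)

lemma ampliation_id:
  assumes "hilbert_tensor t" shows "ampliation t t bop_id = bop_id"
  by (rule bop_eq_on_tensors[OF assms]) (simp add: bop_id.rep_eq ampliation_apply assms)

lemma ampliation_tensor_op_ampliation:
  assumes "hilbert_tensor t" "hilbert_tensor t'"
  shows "ampliation t t' L \<cdot> tensor_op t S B \<cdot> ampliation t' t R = tensor_op t' (L \<cdot> S \<cdot> R) B"
  by (rule bop_eq_on_tensors[OF assms(2)])
    (simp add: bop_comp.rep_eq ampliation_apply tensor_op_apply assms)

lemma bop_comp_id [simp]: "bop_id \<cdot> T = T" "T \<cdot> bop_id = T"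
  by (rule bop_eqI, simp add: bop_comp.rep_eq bop_id.rep_eq)+

lemma bop_comp_assoc: "R \<cdot> S \<cdot> T = R \<cdot> (S \<cdot> T)"
  by (rule bop_eqI) (simp add: bop_comp.rep_eq)

lemma weak_star_tensor_compress:
  assumes t: "hilbert_tensor t" "hilbert_tensor t'"
    and T: "T \<in> weak_star_tensor t V U"
    and V: "\<And>S. S \<in> V \<Longrightarrow> L \<cdot> S \<cdot> R \<in> V'"
  shows "ampliation t t' L \<cdot> T \<cdot> ampliation t' t R \<in> weak_star_tensor t' V' U"
  unfolding weak_star_tensor_iff
proof (intro ballI impI)
  fix \<phi> assume \<phi>: "\<phi> \<in> normal_functionals" "\<forall>S\<in>V'. \<forall>B\<in>U. \<phi> (tensor_op t' S B) = 0"
  have "\<forall>S\<in>V. \<forall>B\<in>U. \<phi> (ampliation t t' L \<cdot> tensor_op t S B \<cdot> ampliation t' t R) = 0"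
    unfolding ampliation_tensor_op_ampliation[OF t] using \<phi>(2) V by blast
  then show "\<phi> (ampliation t t' L \<cdot> T \<cdot> ampliation t' t R) = 0"
    by (rule bspec[OF T[unfolded weak_star_tensor_iff] normal_compose[OF \<phi>(1)], THEN mp])
qed

text \<open>Slicing \<open>(L \<otimes> 1) T (R \<otimes> 1)\<close> by \<open>\<phi>\<close> is slicing \<open>T\<close> by the functional \<open>S \<mapsto> \<phi> (L S R)\<close>, since both
  sides are weak* continuous in \<open>T\<close> and agree on elementary tensors.\<close>

lemma fubini_compress:
  fixes t :: "'h::complex_hilbert \<Rightarrow> 'k::complex_hilbert \<Rightarrow> 'p::complex_hilbert"
    and t' :: "'h'::complex_hilbert \<Rightarrow> 'k \<Rightarrow> 'p'::complex_hilbert"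
  assumes t: "hilbert_tensor t" "hilbert_tensor t'" and V': "csubspace V'"
    and T: "T \<in> fubini t V U"
    and V: "\<And>S. S \<in> V \<Longrightarrow> L \<cdot> S \<cdot> R \<in> V'"
  shows "ampliation t t' L \<cdot> T \<cdot> ampliation t' t R \<in> fubini t' V' U"
  unfolding fubini_def mem_Collect_eq
proof (intro conjI ballI)
  have TW: "T \<in> weak_star_tensor t V UNIV" using T unfolding fubini_def by blast
  show ZW: "ampliation t t' L \<cdot> T \<cdot> ampliation t' t R \<in> weak_star_tensor t' V' UNIV"
    by (rule weak_star_tensor_compress[OF t TW V])
  fix \<omega> assume "\<omega> \<in> predual V'"
  then obtain \<phi> where \<phi>: "\<phi> \<in> normal_functionals" "\<And>S. S \<in> V' \<Longrightarrow> \<omega> S = \<phi> S"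
    by (rule predual_eq_normal[OF V']) blast
  obtain Q where Q: "normal_map Q" "\<And>S B. Q (tensor_op t' S B) = \<phi> S *\<^sub>C B"
    using slice_map_exists[OF t(2) \<phi>(1)] by blast
  have "right_slice t' V' \<omega> (ampliation t t' L \<cdot> T \<cdot> ampliation t' t R)
      = Q (ampliation t t' L \<cdot> T \<cdot> ampliation t' t R)"
    by (rule right_slice_eq[OF Q(1) _ ZW]) (simp add: Q(2) \<phi>(2))
  also have "\<dots> = right_slice t V (\<lambda>S. \<phi> (L \<cdot> S \<cdot> R)) T"
  proof (rule right_slice_eq[OF _ _ TW, symmetric])
    show "normal_map (\<lambda>T. Q (ampliation t t' L \<cdot> T \<cdot> ampliation t' t R))"
      unfolding normal_map_def
    proof (rule ballI)
      fix \<psi> :: "('k, 'k) bop \<Rightarrow> complex" assume "\<psi> \<in> normal_functionals"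
      then have "(\<lambda>T. \<psi> (Q T)) \<in> normal_functionals" using Q(1) unfolding normal_map_def by blast
      then show "(\<lambda>T. \<psi> (Q (ampliation t t' L \<cdot> T \<cdot> ampliation t' t R))) \<in> normal_functionals"
        by (rule normal_compose)
    qed
    show "Q (ampliation t t' L \<cdot> tensor_op t S B \<cdot> ampliation t' t R) = \<phi> (L \<cdot> S \<cdot> R) *\<^sub>C B" for S B
      unfolding ampliation_tensor_op_ampliation[OF t] by (rule Q(2))
  qed
  also have "\<dots> \<in> U"
    using T normal_in_predual[OF normal_compose[OF \<phi>(1)]] unfolding fubini_def by blast
  finally show "right_slice t' V' \<omega> (ampliation t t' L \<cdot> T \<cdot> ampliation t' t R) \<in> U" .
qed

text \<open>A slice map sends \<open>S \<otimes> B\<close> to a multiple of \<open>B\<close>, and \<open>U\<close> is weak* closed.\<close>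

lemma weak_star_tensor_subset_fubini:
  assumes t: "hilbert_tensor t" and V: "csubspace V" and U: "weak_star_closed_subspace U"
  shows "weak_star_tensor t V U \<subseteq> fubini t V U"
proof
  fix T assume T: "T \<in> weak_star_tensor t V U"
  have TW: "T \<in> weak_star_tensor t V UNIV"
    using T unfolding weak_star_tensor_iff by blast
  moreover have "right_slice t V \<omega> T \<in> U" if \<omega>: "\<omega> \<in> predual V" for \<omega>
  proof -
    obtain \<phi> where \<phi>: "\<phi> \<in> normal_functionals" "\<And>S. S \<in> V \<Longrightarrow> \<omega> S = \<phi> S"
      using \<omega> by (rule predual_eq_normal[OF V]) blast
    obtain R where R: "normal_map R" "\<And>S B. R (tensor_op t S B) = \<phi> S *\<^sub>C B"
      using slice_map_exists[OF t \<phi>(1)] by blast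
    have "right_slice t V \<omega> T = R T"
      by (rule right_slice_eq[OF R(1) _ TW]) (simp add: R(2) \<phi>(2))
    also have "R T \<in> U"
    proof (rule weak_star_closed_subspaceI[OF U])
      fix \<psi> :: "_ \<Rightarrow> complex" assume \<psi>: "\<psi> \<in> normal_functionals" "\<And>S. S \<in> U \<Longrightarrow> \<psi> S = 0"
      have "(\<lambda>T. \<psi> (R T)) \<in> normal_functionals" using R(1) \<psi>(1) unfolding normal_map_def by blast
      moreover have "\<forall>S\<in>V. \<forall>B\<in>U. \<psi> (R (tensor_op t S B)) = 0"
        by (simp add: R(2) normal_linear(2)[OF \<psi>(1)] \<psi>(2))
      ultimately show "\<psi> (R T) = 0"
        using T[unfolded weak_star_tensor_iff, rule_format, of "\<lambda>T. \<psi> (R T)"] by blast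
    qed
    finally show ?thesis .
  qed
  ultimately show "T \<in> fubini t V U" unfolding fubini_def by blast
qed

lemma closed_product_zero:
  assumes "T \<in> closed_product X Y" "\<phi> \<in> normal_functionals"
    and "\<And>x y. x \<in> X \<Longrightarrow> y \<in> Y \<Longrightarrow> \<phi> (x \<cdot> y) = 0"
  shows "\<phi> T = 0"
  using assms(1) unfolding closed_product_def
proof (rule normal_closure_zero[OF _ assms(2)])
  fix S assume "S \<in> {(\<Sum>i<k. x i \<cdot> y i) | (k::nat) x y. (\<forall>i<k. x i \<in> X) \<and> (\<forall>i<k. y i \<in> Y)}"
  then obtain k :: nat and x y where S: "S = (\<Sum>i<k. x i \<cdot> y i)" "\<forall>i<k. x i \<in> X" "\<forall>i<k. y i \<in> Y"
    by blast
  have "\<phi> (\<Sum>i<n. x i \<cdot> y i) = 0" if "n \<le> k" for n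
    using that
    by (induction n) (simp_all add: normal_linear[OF assms(2)] normal_vector_space[OF assms(2)] assms(3) S)
  then show "\<phi> S = 0" unfolding S(1) by blast
qed

lemma product_in_closed_product:
  assumes "x \<in> X" "y \<in> Y" shows "x \<cdot> y \<in> closed_product X Y"
proof -
  have "x \<cdot> y \<in> {(\<Sum>i<k. x i \<cdot> y i) | (k::nat) x y. (\<forall>i<k. x i \<in> X) \<and> (\<forall>i<k. y i \<in> Y)}"
    using assms by (intro CollectI exI[of _ "1::nat"] exI[of _ "\<lambda>_. x"] exI[of _ "\<lambda>_. y"]) simp
  then show ?thesis unfolding closed_product_def
    using closure_of_subset[of _ weak_star] by (metis (no_types, lifting) subsetD subset_UNIV topspace_weak_star)
qed

theorem theorem6p1:
  fixes A :: "('h1::complex_hilbert, 'h1) bop set"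
    and B :: "('h2::complex_hilbert, 'h2) bop set"
    and U :: "('k::complex_hilbert, 'k) bop set"
    and t1 :: "'h1 \<Rightarrow> 'k \<Rightarrow> 'p1::complex_hilbert"
    and t2 :: "'h2 \<Rightarrow> 'k \<Rightarrow> 'p2::complex_hilbert"
  assumes "hilbert_tensor t1" and "hilbert_tensor t2"
    and "weak_star_closed_unital_algebra A" and "weak_star_closed_unital_algebra B"
    and "spatially_embedded A B"
    and "weak_star_closed_subspace U"
    and "fubini t2 B U = weak_star_tensor t2 B U"
  shows "fubini t1 A U = weak_star_tensor t1 A U"
proof
  note t1 = assms(1) and t2 = assms(2)
  have A: "csubspace A" "bop_id \<in> A" and B: "csubspace B" "bop_id \<in> B"
    using assms(3,4) by (simp_all add: weak_star_closed_unital_algebra_def weak_star_closed_subspace_def)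
  show "weak_star_tensor t1 A U \<subseteq> fubini t1 A U"
    by (rule weak_star_tensor_subset_fubini[OF t1 A(1) assms(6)])
  obtain X :: "('h1, 'h2) bop set" and Y :: "('h2, 'h1) bop set" where
    XY: "bimodule B A X" "bimodule A B Y" "closed_product X Y \<subseteq> B" "closed_product Y X = A"
    using assms(5) unfolding spatially_embedded_def by blast
  have XA: "x \<cdot> a \<in> X" if "x \<in> X" "a \<in> A" for x a
    using XY(1) B(2) that unfolding bimodule_def by (metis bop_comp_id(1))
  have YB: "y \<cdot> b \<in> Y" if "y \<in> Y" "b \<in> B" for y b
    using XY(2) A(2) that unfolding bimodule_def by (metis bop_comp_id(1))
  have XAY: "x \<cdot> a \<cdot> y \<in> B" if "x \<in> X" "a \<in> A" "y \<in> Y" for x a y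
    using product_in_closed_product[OF XA[OF that(1,2)] that(3)] XY(3) by blast
  have YBX: "y \<cdot> b \<cdot> x \<in> A" if "y \<in> Y" "b \<in> B" "x \<in> X" for x b y
    using product_in_closed_product[OF YB[OF that(1,2)] that(3)] XY(4) by blast
  let ?a = "ampliation t1 t1"
  show "fubini t1 A U \<subseteq> weak_star_tensor t1 A U"
  proof
    fix T assume T: "T \<in> fubini t1 A U"
    \<comment> \<open>compressed into \<open>B\<close> by \<open>x\<close> and \<open>y'\<close>, where the hypothesis on \<open>B\<close> applies, and back into \<open>A\<close> by
      \<open>y\<close> and \<open>x'\<close>\<close>
    have compressed: "?a (y \<cdot> x) \<cdot> T \<cdot> ?a (y' \<cdot> x') \<in> weak_star_tensor t1 A U"
      if "x \<in> X" "y \<in> Y" "x' \<in> X" "y' \<in> Y" for x y x' y'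
    proof -
      have "ampliation t1 t2 x \<cdot> T \<cdot> ampliation t2 t1 y' \<in> fubini t2 B U"
        by (rule fubini_compress[OF t1 t2 B(1) T XAY]) (use that in auto)
      then have "ampliation t2 t1 y \<cdot> (ampliation t1 t2 x \<cdot> T \<cdot> ampliation t2 t1 y') \<cdot> ampliation t1 t2 x'
          \<in> weak_star_tensor t1 A U"
        unfolding assms(7) by (rule weak_star_tensor_compress[OF t2 t1 _ YBX]) (use that in auto)
      then show ?thesis
        unfolding ampliation_comp[OF t1 t2 t1, symmetric] bop_comp_assoc .
    qed
    show "T \<in> weak_star_tensor t1 A U"
      unfolding weak_star_tensor_iff
    proof (intro ballI impI)
      fix \<phi> assume \<phi>: "\<phi> \<in> normal_functionals" "\<forall>S\<in>A. \<forall>B\<in>U. \<phi> (tensor_op t1 S B) = 0"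
      have id: "bop_id \<in> closed_product Y X" using A(2) XY(4) by simp
      have 0: "\<phi> (?a (y \<cdot> x) \<cdot> T \<cdot> ?a (y' \<cdot> x')) = 0"
        if "x \<in> X" "y \<in> Y" "x' \<in> X" "y' \<in> Y" for x y x' y'
        using compressed[OF that] \<phi> unfolding weak_star_tensor_iff by blast
      \<comment> \<open>replace first \<open>y x\<close> and then \<open>y' x'\<close> by the identity, a weak* limit of sums of such products\<close>
      have 1: "\<phi> (T \<cdot> ?a (y' \<cdot> x')) = 0" if "x' \<in> X" "y' \<in> Y" for x' y'
      proof -
        have "(\<lambda>S. \<phi> (bop_id \<cdot> S \<cdot> (T \<cdot> ?a (y' \<cdot> x')))) \<in> normal_functionals"
          by (rule normal_compose[OF \<phi>(1)])
        from normal_ampliation[OF t1 t1 this]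
        have "\<phi> (bop_id \<cdot> ?a bop_id \<cdot> (T \<cdot> ?a (y' \<cdot> x'))) = 0"
          by (rule closed_product_zero[OF id]) (use 0 that in \<open>simp add: bop_comp_assoc\<close>)
        then show ?thesis by (simp add: ampliation_id[OF t1])
      qed
      have "(\<lambda>S. \<phi> (T \<cdot> S \<cdot> bop_id)) \<in> normal_functionals" by (rule normal_compose[OF \<phi>(1)])
      from normal_ampliation[OF t1 t1 this]
      have "\<phi> (T \<cdot> ?a bop_id \<cdot> bop_id) = 0"
        by (rule closed_product_zero[OF id]) (use 1 in simp)
      then show "\<phi> T = 0" by (simp add: ampliation_id[OF t1])
    qed
  qed
qed

end
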